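(* Assume the Gaussian sequence model with $p_n/n\to0$. Let $\rho_n^0$ be a sequence, let $\gamma_n$ be a sequence with $1\le\gamma_n\le p_n$, and let $\hat p$ be an estimator of $p_n$ such that, for some constant $C^u>0$, $\mathbb P^n_\theta(\gamma_n\le\hat p\le C^up_n)=1-o(1)$ uniformly over all $\theta$ with $|S_0|=p_n$ and $\min_{i\in S_0}|\theta_i|\ge\rho_n^0$. Assume the prior $\pi$ satisfies Conditions 1, 2 and 3($C$) with $p=\hat p$, and let $\xi_i=\mathbf 1\{m^{\hat p}_{X_i}>\alpha\}$ for fixed $\alpha\in(0,1)$. Then there is a constant $C_1$ (depending only on $\alpha,u_*,u_0,R,b,b',C'$) such that for all sequences $v_n\to\infty$, with $\rho_n=C_1+\sqrt{2K(u_0+1)\log(n/\gamma_n)}+v_n$, and all $0<\lambda<\Phi(v_n)$, $$\sup_{\theta:\ |S_0|=p_n,\ \min_{i\in S_0}|\theta_i|\ge\rho_n\vee\rho_n^0}R_n^{sup}(\Xi)\le\left(\frac{1}{1+\frac{\lambda\alpha c}{8C^uC\sqrt\pi}}+\Phi(-v_n)\right)(1+o(1)).$$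
   Context: Model: $X_i=\theta_i+\epsilon_i$, $i=1,\dots,n$, $\epsilon_i$ i.i.d. $\mathcal N(0,1)$; $\mathbb P^n_\theta,\mathbb E_\theta$ refer to this model with parameter $\theta$. Prior: $\theta_i\mid\sigma_i^2\sim\mathcal N(0,\sigma_i^2)$, $\sigma_i^2\sim\pi$ independently, $\pi$ a density on $(0,\infty)$ allowed to depend on $p$; $m^{p}_x$ denotes $$m_x=\frac{\int_0^\infty u(1+u)^{-3/2}e^{\frac{x^2}{2}\frac{u}{1+u}}\pi(u)\,du}{\int_0^\infty (1+u)^{-1/2}e^{\frac{x^2}{2}\frac{u}{1+u}}\pi(u)\,du}$$ computed with the prior corresponding to $p$. Notation: $\tau_n(p)=p/n$, $\nu_n(p)=\sqrt{\log(n/p)}$, $s_n=\tau_n(p)\nu_n(p)^2$; $\Phi$ standard normal cdf; $a\vee b=\max(a,b)$. Uniformly regularly varying at infinity: there exist $R,u_0>0$ with $1/R\le L(au)/L(u)\le R$ for all $a\in[1,2]$, $u\ge u_0$. Condition 1: for some $b\ge0$, $\pi(u)=L_n(u)e^{-bu}$, $L_n$ uniformly regularly varying with $R,u_0$ independent of $n$; constants $C',b'>0$, $K\ge0$, $u_*\ge1$ with $C'\pi(u)\ge\tau_n(p)^Ke^{-b'u}$ for $u\ge u_*$. Condition 2: $\int_0^1\pi(u)du\ge c>0$. Condition 3($C$): $\int_{s_n}^\infty\big(u\wedge\frac{\nu_n(p)^3}{\sqrt u}\big)\pi(u)du+\nu_n(p)\int_1^{\nu_n(p)^2}\frac{\pi(u)}{\sqrt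 u}du\le Cs_n$. $S_0=\{i:\theta_i\ne0\}$; $FDR_n(\Xi)=\mathbb E_\theta\big(\frac{\sum_{i\in S_0^c}\xi_i}{(\sum_i\xi_i)\vee1}\big)$, $FNR_n(\Xi)=\mathbb E_\theta\big(\frac{\sum_{i\in S_0}(1-\xi_i)}{p_n}\big)$, $R^{sup}_n=FDR_n+FNR_n$. *)

theory Defs
  imports "HOL-Probability.Probability"
begin

definition gauss_model :: "nat \<Rightarrow> (nat \<Rightarrow> real) \<Rightarrow> (nat \<Rightarrow> real) measure" where
  "gauss_model n \<theta> = PiM {..<n} (\<lambda>i. density lborel (normal_density (\<theta> i) 1))"

definition Phi :: "real \<Rightarrow> real" where
  "Phi x = (\<integral>t\<in>{..x}. std_normal_density t \<partial>lborel)"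

definition tau_n :: "nat \<Rightarrow> real \<Rightarrow> real" where
  "tau_n n p = p / real n"

definition nu_n :: "nat \<Rightarrow> real \<Rightarrow> real" where
  "nu_n n p = sqrt (ln (real n / p))"

definition s_n :: "nat \<Rightarrow> real \<Rightarrow> real" where
  "s_n n p = tau_n n p * (nu_n n p)\<^sup>2"

definition m_post :: "(real \<Rightarrow> real) \<Rightarrow> real \<Rightarrow> real" where
  "m_post \<pi> x =
     (\<integral>u\<in>{0<..}. u * (1 + u) powr (-3/2) * exp (x\<^sup>2 / 2 * (u / (1 + u))) * \<pi> u \<partial>lborel) /
     (\<integral>u\<in>{0<..}. (1 + u) powr (-1/2) * exp (x\<^sup>2 / 2 * (u / (1 + u))) * \<pi> u \<partial>lborel)"

definition prior_density :: "(real \<Rightarrow> real) \<Rightarrow> bool" where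
  "prior_density \<pi> \<longleftrightarrow> (\<forall>u>0. 0 \<le> \<pi> u) \<and> set_integrable lborel {0<..} \<pi>
      \<and> (\<integral>u\<in>{0<..}. \<pi> u \<partial>lborel) = 1"

definition unif_reg_varying :: "(real \<Rightarrow> real) \<Rightarrow> real \<Rightarrow> real \<Rightarrow> bool" where
  "unif_reg_varying L R u0 \<longleftrightarrow> R > 0 \<and> u0 > 0 \<and>
     (\<forall>a\<in>{1..2}. \<forall>u\<ge>u0. 1 / R \<le> L (a * u) / L u \<and> L (a * u) / L u \<le> R)"

definition cond1 :: "(real \<Rightarrow> real) \<Rightarrow> nat \<Rightarrow> real \<Rightarrow> real \<Rightarrow> real \<Rightarrow> real \<Rightarrow> real \<Rightarrow> real
     \<Rightarrow> real \<Rightarrow> real \<Rightarrow> bool" where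
  "cond1 \<pi> n p b R u0 C' b' K ustar \<longleftrightarrow> b \<ge> 0 \<and>
     (\<exists>L. (\<forall>u>0. \<pi> u = L u * exp (- b * u)) \<and> unif_reg_varying L R u0) \<and>
     C' > 0 \<and> b' > 0 \<and> K \<ge> 0 \<and> ustar \<ge> 1 \<and>
     (\<forall>u\<ge>ustar. C' * \<pi> u \<ge> (tau_n n p) powr K * exp (- b' * u))"

definition cond2 :: "(real \<Rightarrow> real) \<Rightarrow> real \<Rightarrow> bool" where
  "cond2 \<pi> c \<longleftrightarrow> c > 0 \<and> (\<integral>u\<in>{0<..1}. \<pi> u \<partial>lborel) \<ge> c"

definition cond3 :: "(real \<Rightarrow> real) \<Rightarrow> nat \<Rightarrow> real \<Rightarrow> real \<Rightarrow> bool" where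
  "cond3 \<pi> n p C \<longleftrightarrow>
     (\<integral>u\<in>{s_n n p..}. min u ((nu_n n p) ^ 3 / sqrt u) * \<pi> u \<partial>lborel)
     + nu_n n p * (\<integral>u\<in>{1..(nu_n n p)\<^sup>2}. \<pi> u / sqrt u \<partial>lborel) \<le> C * s_n n p"

definition S0 :: "nat \<Rightarrow> (nat \<Rightarrow> real) \<Rightarrow> nat set" where
  "S0 n \<theta> = {i \<in> {..<n}. \<theta> i \<noteq> 0}"

text \<open>A multiple test: Xi X i in {0,1} is the decision for coordinate i given data X.\<close>
definition FDR :: "nat \<Rightarrow> (nat \<Rightarrow> real) \<Rightarrow> ((nat \<Rightarrow> real) \<Rightarrow> nat \<Rightarrow> real) \<Rightarrow> real" where
  "FDR n \<theta> Xi = (\<integral>X. (\<Sum>i\<in>{..<n} - S0 n \<theta>. Xi X i) / max (\<Sum>i<n. Xi X i) 1 \<partial>gauss_model n \<theta>)"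

definition FNR :: "nat \<Rightarrow> (nat \<Rightarrow> real) \<Rightarrow> nat \<Rightarrow> ((nat \<Rightarrow> real) \<Rightarrow> nat \<Rightarrow> real) \<Rightarrow> real" where
  "FNR n \<theta> pn Xi = (\<integral>X. (\<Sum>i\<in>S0 n \<theta>. 1 - Xi X i) / real pn \<partial>gauss_model n \<theta>)"

definition Rsup :: "nat \<Rightarrow> (nat \<Rightarrow> real) \<Rightarrow> nat \<Rightarrow> ((nat \<Rightarrow> real) \<Rightarrow> nat \<Rightarrow> real) \<Rightarrow> real" where
  "Rsup n \<theta> pn Xi = FDR n \<theta> Xi + FNR n \<theta> pn Xi"

definition xi_test :: "(nat \<Rightarrow> real \<Rightarrow> real \<Rightarrow> real) \<Rightarrow> (nat \<Rightarrow> (nat \<Rightarrow> real) \<Rightarrow> real) \<Rightarrow> real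
     \<Rightarrow> nat \<Rightarrow> (nat \<Rightarrow> real) \<Rightarrow> nat \<Rightarrow> real" where
  "xi_test pri phat \<alpha> n X i = (if m_post (pri n (phat n X)) (X i) > \<alpha> then 1 else 0)"

end

(* The shrinkage weight m_x is the posterior mean of u/(1+u) when u has weight
   (1+u)^(-1/2) exp(x^2/2 * u/(1+u)) pi(u), and everything rests on two bounds for it.

   Signals: 1 - m_x splits over u < u0, u0 <= u <= U and u > U.  The last part is at most 1/(1+U);
   the middle one is compared with the weight on [2U, 4U] by regular variation, where the exponent
   is larger by a factor of x^2; the first one is compared with the weight on [|x|, |x|+1] by the
   lower bound tau^K exp(-b' u) on pi.  There the gain x^2 / (2(u0+1)) pays for K log(n/p), and the
   excess of |x| over sqrt(2K(u0+1) log(n/p)) pays for the terms linear in |x|.  So a signal is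
   missed only if its noise is below -v_n.

   Nulls: Conditions 2 and 3 bound m_x by a function that increases with |x| and with p.  As the
   estimate of p is at most C^u p_n, the data-dependent test rejects nothing below one deterministic
   threshold T with exp(T^2/2) of order n / (p_n nu_n), and the Gaussian tail bound gives
   O(p_n) expected exceedances.

   The false discovery proportion is at most w / (w + lambda p_n), where w counts the exceedances,
   off an event of vanishing probability; this is concave in w, so its tangent line at the bound for
   the mean of w replaces Jensen's inequality. *)

theory Submission
  imports Defs "HOL-Real_Asymp.Real_Asymp"
begin

section \<open>Detection of large observations\<close>

text \<open>The prior is unconstrained on u \<le> 0, so the indicator stays attached to \<pi> and
  measurability is read off from the integrability of that product. All later integrals keep this
  shape, so a bound on \<open>g\<close> matters for u > 0 only.\<close>

lemma prior_integrable:
  assumes "prior_density \<pi>" and [measurable]: "g \<in> borel_measurable borel"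
    and "\<And>u. u > 0 \<Longrightarrow> \<bar>g u\<bar> \<le> B"
  shows "integrable lborel (\<lambda>u. g u * (indicator {0<..} u * \<pi> u))"
proof -
  have i: "integrable lborel (\<lambda>u. indicator {0<..} u * \<pi> u)"
    using assms(1) by (simp add: prior_density_def set_integrable_def)
  then have [measurable]: "(\<lambda>u. indicator {0<..} u * \<pi> u) \<in> borel_measurable borel"
    using borel_measurable_integrable by fastforce
  show ?thesis
  proof (rule Bochner_Integration.integrable_bound[OF integrable_mult_right[OF i, of B]])
    show "AE u in lborel. norm (g u * (indicator {0<..} u * \<pi> u)) \<le> norm (B * (indicator {0<..} u * \<pi> u))"
    proof (rule AE_I2)
      fix u :: real
      show "norm (g u * (indicator {0<..} u * \<pi> u)) \<le> norm (B * (indicator {0<..} u * \<pi> u))"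
        using assms(3)[of u] by (cases "u > 0") (auto simp: abs_mult intro!: mult_right_mono)
    qed
  qed simp
qed

lemma prior_nonneg: "prior_density \<pi> \<Longrightarrow> 0 \<le> indicator {0<..} u * \<pi> u"
  by (auto simp: prior_density_def indicator_def)

lemma prior_integral: "prior_density \<pi> \<Longrightarrow> (\<integral>u. indicator {0<..} u * \<pi> u \<partial>lborel) = 1"
  by (simp add: prior_density_def set_lebesgue_integral_def)

text \<open>This is the ratio at x of the N(0, 1+u) density, the law of an observation whose mean
  has prior variance u, to the N(0, 1) density.\<close>

definition weight :: "real \<Rightarrow> real \<Rightarrow> real" where
  "weight x u = (1 + u) powr (-1/2) * exp (x\<^sup>2 / 2 * (u / (1 + u)))"

lemma weight_measurable [measurable]: "weight x \<in> borel_measurable borel"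
  unfolding weight_def by measurable

lemma weight_bounds: "u > 0 \<Longrightarrow> \<bar>weight x u\<bar> \<le> exp (x\<^sup>2 / 2 * (u / (1 + u)))"
proof -
  assume "u > 0"
  then have "(1 + u) powr (-1/2) \<le> (1 + u) powr 0" by (intro powr_mono) auto
  then have "(1 + u) powr (-1/2) \<le> 1" using \<open>u > 0\<close> by simp
  then show ?thesis unfolding weight_def
    by (simp add: abs_mult mult_left_le_one_le)
qed

lemma weight_bound: "u > 0 \<Longrightarrow> \<bar>weight x u\<bar> \<le> exp (x\<^sup>2 / 2)"
proof -
  assume u: "u > 0"
  then have "u / (1 + u) \<le> 1" by simp
  then have "x\<^sup>2 / 2 * (u / (1 + u)) \<le> x\<^sup>2 / 2" by (intro mult_left_le) auto
  then show ?thesis using weight_bounds[OF u, of x] by (meson exp_le_cancel_iff order_trans)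
qed

lemma weight_nonneg: "0 \<le> weight x u"
  by (simp add: weight_def)

lemma m_post_weight:
  "m_post \<pi> x = (\<integral>u. u / (1 + u) * weight x u * (indicator {0<..} u * \<pi> u) \<partial>lborel) /
     (\<integral>u. weight x u * (indicator {0<..} u * \<pi> u) \<partial>lborel)"
proof -
  have "u * (1 + u) powr (-3/2) = u / (1 + u) * (1 + u) powr (-1/2)" if "u > 0" for u :: real
  proof -
    have "(1 + u) powr (-3/2) = (1 + u) powr (-1/2 - 1)" by simp
    also have "\<dots> = (1 + u) powr (-1/2) / (1 + u)"
      using that by (subst powr_diff) simp
    finally show ?thesis by simp
  qed
  then show ?thesis
    unfolding m_post_def set_lebesgue_integral_def weight_def
    by (intro arg_cong2[where f="(/)"] Bochner_Integration.integral_cong) (auto simp: indicator_def)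
qed

lemma prior_weight_integrable:
  assumes "prior_density \<pi>" shows "integrable lborel (\<lambda>u. weight x u * (indicator {0<..} u * \<pi> u))"
  by (rule prior_integrable[OF assms _ weight_bound]) auto

lemma prior_shrunk_weight_integrable:
  assumes "prior_density \<pi>"
  shows "integrable lborel (\<lambda>u. u / (1 + u) * weight x u * (indicator {0<..} u * \<pi> u))"
proof (rule prior_integrable[OF assms])
  fix u :: real assume u: "u > 0"
  then have "\<bar>u / (1 + u) * weight x u\<bar> \<le> 1 * \<bar>weight x u\<bar>"
    unfolding abs_mult by (intro mult_right_mono) auto
  then show "\<bar>u / (1 + u) * weight x u\<bar> \<le> exp (x\<^sup>2 / 2)" using weight_bound[OF u, of x] by simp
qed simp

text \<open>Serves to bound the denominator of \<open>m_post\<close> from below: everything outside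
  one interval is discarded.\<close>

lemma prior_weight_ge:
  assumes "prior_density \<pi>" "a > 0" "a \<le> d" "\<And>u. a \<le> u \<Longrightarrow> u \<le> d \<Longrightarrow> y \<le> weight x u * \<pi> u"
  shows "(d - a) * y \<le> (\<integral>u. weight x u * (indicator {0<..} u * \<pi> u) \<partial>lborel)"
proof -
  have "(d - a) * y = (\<integral>u. indicator {a..d} u * y \<partial>lborel)" using assms(3) by simp
  also have "\<dots> \<le> (\<integral>u. weight x u * (indicator {0<..} u * \<pi> u) \<partial>lborel)"
  proof (rule integral_mono[OF _ prior_weight_integrable[OF assms(1)]])
    show "integrable lborel (\<lambda>u. indicator {a..d} u * y)" by (simp add: assms(3))
    show "indicator {a..d} u * y \<le> weight x u * (indicator {0<..} u * \<pi> u)" for u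
      using assms(2,4) prior_nonneg[OF assms(1), of u] weight_nonneg[of x u]
      by (cases "u \<in> {a..d}") auto
  qed
  finally show ?thesis .
qed

section \<open>Regular variation over finitely many doublings\<close>

text \<open>At a = 1 the two bounds enclose the same quotient, so 1/R \<le> R whatever that quotient
  is.\<close>

lemma unif_reg_varying_ge_1: "unif_reg_varying L R u0 \<Longrightarrow> R \<ge> 1"
proof -
  assume a: "unif_reg_varying L R u0"
  then have "R > 0" "1 / R \<le> R" unfolding unif_reg_varying_def
    by (auto dest!: bspec[of _ _ 1] order_trans)
  then have "1 \<le> R * R" by (simp add: field_simps)
  then show "R \<ge> 1" using \<open>R > 0\<close> by (metis less_1_mult linorder_not_less mult_le_one mult_less_cancel_left2 mult.commute nle_le order_less_le)
qed

text \<open>Division by 0 gives 0, so a zero of L would make the quotient at a = 1 smaller than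
  1/R.\<close>

lemma unif_reg_varying_pos:
  assumes "unif_reg_varying L R u0" "u \<ge> u0" "L u \<ge> 0" shows "L u > 0"
proof -
  have "R > 0" "1 / R \<le> L (1 * u) / L u"
    using assms by (auto simp: unif_reg_varying_def dest!: bspec[of _ _ 1])
  then show ?thesis using assms(3) by (cases "L u = 0") (auto simp: divide_simps)
qed

text \<open>Each doubling costs one factor R. In the induction step a point beyond 2^k u0 is reached
  from 2^k u0 itself by a single factor in [1, 2].\<close>

lemma unif_reg_varying_bounds:
  assumes "unif_reg_varying L R u0" "\<And>u. u \<ge> u0 \<Longrightarrow> L u \<ge> 0" "u0 \<le> u" "u \<le> 2 ^ k * u0"
  shows "L u0 / R ^ k \<le> L u" "L u \<le> R ^ k * L u0"
proof -
  have R: "R \<ge> 1" using unif_reg_varying_ge_1[OF assms(1)] .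
  have u0: "u0 > 0" using assms(1) by (simp add: unif_reg_varying_def)
  have "L u0 / R ^ k \<le> L u \<and> L u \<le> R ^ k * L u0" using assms(3,4)
  proof (induction k arbitrary: u)
    case 0
    then show ?case by simp
  next
    case (Suc k)
    have p: "L u0 > 0" using unif_reg_varying_pos[OF assms(1) order_refl] assms(2)[of u0] by simp
    show ?case
    proof (cases "u \<le> 2 ^ k * u0")
      case True
      have IH: "L u0 / R ^ k \<le> L u" "L u \<le> R ^ k * L u0" using Suc.IH[OF Suc.prems(1) True] by auto
      have "L u0 / R ^ Suc k \<le> L u0 / R ^ k" using R p
        by (intro divide_left_mono mult_pos_pos power_increasing) auto
      moreover have "R ^ k * L u0 \<le> R ^ Suc k * L u0" using R p
        by (intro mult_right_mono power_increasing) auto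
      ultimately show ?thesis using IH by linarith
    next
      case False
      define v where "v = 2 ^ k * u0"
      have v: "v \<ge> u0" "v > 0" using u0 by (auto simp: v_def)
      define a where "a = u / v"
      have a: "a \<in> {1..2}" "u = a * v" using False Suc.prems v by (auto simp: a_def v_def field_simps)
      have IH: "L u0 / R ^ k \<le> L v" "L v \<le> R ^ k * L u0" using Suc.IH[OF v(1)] by (auto simp: v_def)
      have Lv: "L v > 0" using unif_reg_varying_pos[OF assms(1) v(1)] assms(2) v by simp
      have "1 / R \<le> L u / L v" "L u / L v \<le> R"
        using assms(1) a v by (auto simp: unif_reg_varying_def)
      then have 1: "L v / R \<le> L u" "L u \<le> R * L v" using Lv R by (auto simp: field_simps)
      have "L u0 / R ^ Suc k \<le> L v / R" using IH(1) R by (simp add: field_simps)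
      moreover have "R * L v \<le> R ^ Suc k * L u0" using IH(2) R by simp
      ultimately show ?thesis using 1 by linarith
    qed
  qed
  then show "L u0 / R ^ k \<le> L u" "L u \<le> R ^ k * L u0" by auto
qed

section \<open>Bounding 1 - m_x for large observations\<close>

text \<open>With numerator N and denominator D, the difference D - N is the integral of the weight
  divided by 1 + u. Each of the three ranges of u contributes at most (1-\<alpha>)D/4, which leaves
  a quarter to spare for strictness.\<close>

lemma m_post_gt_criterion:
  assumes pd: "prior_density \<pi>" and U: "0 < u0" "u0 \<le> U" "4 / (1 - \<alpha>) \<le> 1 + U"
    and \<alpha>: "\<alpha> < 1"
    and D: "D = (\<integral>u. weight x u * (indicator {0<..} u * \<pi> u) \<partial>lborel)"
    and I1: "4 / (1 - \<alpha>) * exp (x\<^sup>2 / 2 * (u0 / (1 + u0))) \<le> D"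
    and I2: "\<And>u. u0 \<le> u \<Longrightarrow> u \<le> U \<Longrightarrow> 4 / (1 - \<alpha>) * U * (weight x u * \<pi> u) \<le> D"
  shows "m_post \<pi> x > \<alpha>"
proof -
  let ?f = "\<lambda>u. indicator {0<..} u * \<pi> u"
  let ?e = "exp (x\<^sup>2 / 2 * (u0 / (1 + u0)))"
  define N where "N = (\<integral>u. u / (1 + u) * weight x u * ?f u \<partial>lborel)"
  have iN: "integrable lborel (\<lambda>u. u / (1 + u) * weight x u * ?f u)"
    by (rule prior_shrunk_weight_integrable[OF pd])
  have iD: "integrable lborel (\<lambda>u. weight x u * ?f u)" by (rule prior_weight_integrable[OF pd])
  have if': "integrable lborel ?f" using pd by (simp add: prior_density_def set_integrable_def)
  have q: "(1 - \<alpha>) / 4 > 0" using \<alpha> by simp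
  have e0: "?e > 0" by simp
  have "4 / (1 - \<alpha>) * ?e > 0" using \<alpha> by simp
  then have Dpos: "D > 0" using I1 by linarith
  \<comment> \<open>One summand for each of the ranges u < u0, [u0, U] and u > U; all are
    nonnegative, so the sum is a majorant everywhere.\<close>
  let ?b = "\<lambda>u. ?e * ?f u + indicator {u0..U} u * ((1 - \<alpha>) / 4 * D / U) + (1 - \<alpha>) / 4 * (weight x u * ?f u)"
  have ib: "integrable lborel ?b"
    by (intro Bochner_Integration.integrable_add integrable_mult_right iD if') (simp add: U)
  have "D - N = (\<integral>u. weight x u * ?f u - u / (1 + u) * weight x u * ?f u \<partial>lborel)"
    unfolding D N_def by (rule Bochner_Integration.integral_diff[symmetric, OF iD iN])
  also have "\<dots> \<le> (\<integral>u. ?b u \<partial>lborel)"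
  proof (rule integral_mono[OF Bochner_Integration.integrable_diff[OF iD iN] ib])
    fix u :: real
    have nn: "0 \<le> ?f u" "0 \<le> weight x u" using prior_nonneg[OF pd] weight_nonneg by auto
    have nn2: "0 \<le> weight x u * ?f u" "0 \<le> ?e * ?f u" "0 \<le> indicator {u0..U} u * ((1 - \<alpha>) / 4 * D / U)"
      using nn U \<alpha> Dpos by auto
    show "weight x u * ?f u - u / (1 + u) * weight x u * ?f u \<le> ?b u"
    proof (cases "u > 0")
      case False then show ?thesis using U by auto
    next
      case True
      have eq: "weight x u * ?f u - u / (1 + u) * weight x u * ?f u = weight x u * ?f u / (1 + u)"
        using True by (simp add: field_simps)
      have le: "weight x u * ?f u / (1 + u) \<le> weight x u * ?f u"
        using True nn2(1) divide_left_mono[of 1 "1 + u" "weight x u * ?f u"] by simp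
      consider "u < u0" | "u0 \<le> u" "u \<le> U" | "U < u" by linarith
      then show ?thesis
      proof cases
        case 1
        have "u / (1 + u) \<le> u0 / (1 + u0)" using True 1 by (simp add: field_simps)
        then have "exp (x\<^sup>2 / 2 * (u / (1 + u))) \<le> ?e"
          by (simp add: mult_left_mono del: times_divide_eq_left times_divide_eq_right)
        then have "weight x u \<le> ?e" using weight_bounds[OF True, of x] nn by linarith
        then have "weight x u * ?f u \<le> ?e * ?f u" using nn by (intro mult_right_mono) auto
        then show ?thesis using eq le nn2 q by (smt (verit) mult_nonneg_nonneg)
      next
        case 2
        have "weight x u * \<pi> u \<le> (1 - \<alpha>) / 4 * D / U" using I2[OF 2] \<alpha> U by (simp add: field_simps)
        then have "weight x u * ?f u \<le> indicator {u0..U} u * ((1 - \<alpha>) / 4 * D / U)" using 2 True by simp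
        then show ?thesis using eq le nn2 q by (smt (verit) mult_nonneg_nonneg)
      next
        case 3
        have "1 / (1 + u) \<le> 1 / (1 + U)" using U 3 by (simp add: field_simps)
        also have "\<dots> \<le> (1 - \<alpha>) / 4" using U \<alpha> by (simp add: field_simps)
        finally have "1 / (1 + u) \<le> (1 - \<alpha>) / 4" .
        then have "weight x u * ?f u * (1 / (1 + u)) \<le> weight x u * ?f u * ((1 - \<alpha>) / 4)"
          using nn2 by (intro mult_left_mono) auto
        then have "weight x u * ?f u / (1 + u) \<le> (1 - \<alpha>) / 4 * (weight x u * ?f u)"
          by (simp add: mult.commute)
        then show ?thesis using eq nn2 by linarith
      qed
    qed
  qed
  also have "\<dots> = ?e + (U - u0) * ((1 - \<alpha>) / 4 * D / U) + (1 - \<alpha>) / 4 * D"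
    using iD if' prior_integral[OF pd] U by (simp add: D)
  also have "\<dots> \<le> (1 - \<alpha>) / 4 * D + (1 - \<alpha>) / 4 * D + (1 - \<alpha>) / 4 * D"
  proof -
    have "?e \<le> (1 - \<alpha>) / 4 * D" using I1 \<alpha> by (simp add: field_simps)
    moreover have "(U - u0) * ((1 - \<alpha>) / 4 * D / U) \<le> U * ((1 - \<alpha>) / 4 * D / U)"
      using U q Dpos by (intro mult_right_mono) auto
    moreover have "U * ((1 - \<alpha>) / 4 * D / U) = (1 - \<alpha>) / 4 * D" using U by simp
    ultimately show ?thesis by linarith
  qed
  also have "\<dots> < (1 - \<alpha>) * D" using \<alpha> Dpos by (simp add: field_simps)
  finally have "N > \<alpha> * D" by (simp add: algebra_simps)
  then have "N / D > \<alpha>" using Dpos by (simp add: field_simps)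
  then show ?thesis unfolding m_post_weight N_def D .
qed

text \<open>The power factor decreases in u and the exponential factor increases, so one is
  evaluated at the right end and the other at the left end.\<close>

lemma weight_ge:
  assumes "0 < a" "a \<le> u" "u \<le> d"
  shows "(1 + d) powr (-1/2) * exp (x\<^sup>2 / 2 * (a / (1 + a))) \<le> weight x u"
  unfolding weight_def
proof (rule mult_mono)
  show "(1 + d) powr (-1/2) \<le> (1 + u) powr (-1/2)"
    using assms by (intro powr_mono2') auto
  have "a / (1 + a) \<le> u / (1 + u)" using assms by (simp add: field_simps)
  then show "exp (x\<^sup>2 / 2 * (a / (1 + a))) \<le> exp (x\<^sup>2 / 2 * (u / (1 + u)))"
    by (simp add: mult_left_mono del: times_divide_eq_left times_divide_eq_right)
qed auto

text \<open>Pays for the range u < u0, where the weight is at most exp(x^2/2 * u0/(1+u0)), out of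
  the mass on [|x|, |x|+1]. There the exponent falls short of x^2/2 by at most |x|/2, while at u0 it
  falls short by x^2/(2(1+u0)).\<close>

lemma prior_weight_ge_tail:
  fixes x :: real
  assumes pd: "prior_density \<pi>" and c1: "cond1 \<pi> n p b R u0 C' b' K ustar"
    and p: "0 < p" "p \<le> real n"
    and x: "\<bar>x\<bar> \<ge> C1 + sqrt (2 * K * (u0 + 1) * ln (real n / p))"
    and C1: "C1 \<ge> ustar" "C1 \<ge> 2 * (1 + u0) * (3 / 2 + 2 * b' + \<bar>ln C'\<bar> + \<bar>ln q\<bar>)" and q: "q > 0"
  shows "q * exp (x\<^sup>2 / 2 * (u0 / (1 + u0))) \<le> (\<integral>u. weight x u * (indicator {0<..} u * \<pi> u) \<partial>lborel)"
proof -
  have c: "C' > 0" "b' > 0" "K \<ge> 0" "ustar \<ge> 1" "u0 > 0" "\<And>u. u \<ge> ustar \<Longrightarrow> C' * \<pi> u \<ge> tau_n n p powr K * exp (- b' * u)"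
    using c1 by (auto simp: cond1_def unif_reg_varying_def)
  define l where "l = ln (real n / p)"
  define T where "T = \<bar>x\<bar>"
  define A where "A = sqrt (2 * K * (u0 + 1) * l)"
  have l: "l \<ge> 0" using p by (simp add: l_def)
  have A: "A \<ge> 0" "A\<^sup>2 = 2 * K * (u0 + 1) * l" using c l by (auto simp: A_def)
  have T: "T \<ge> C1 + A" using x by (simp add: T_def A_def l_def)
  then have T1: "T \<ge> 1" "T \<ge> ustar" using C1 c A by auto
  have tau: "tau_n n p powr K = exp (- K * l)" using p
    by (simp add: tau_n_def powr_def l_def ln_div right_diff_distrib algebra_simps)
  \<comment> \<open>A lower bound for the weighted prior on [T, T+1], written as a single
    exponential so that only exponents have to be compared.\<close>
  define y where "y = exp (- ln (2 + T) / 2 + x\<^sup>2 / 2 * (T / (1 + T)) - K * l - b' * (T + 1) - ln C')"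
  have "(T + 1 - T) * y \<le> (\<integral>u. weight x u * (indicator {0<..} u * \<pi> u) \<partial>lborel)"
  proof (rule prior_weight_ge[OF pd])
    fix u assume u: "T \<le> u" "u \<le> T + 1"
    have 1: "(1 + (T + 1)) powr (-1/2) * exp (x\<^sup>2 / 2 * (T / (1 + T))) \<le> weight x u"
      using u T1 by (intro weight_ge) auto
    have "exp (- b' * (T + 1)) \<le> exp (- b' * u)" using u c by simp
    then have "exp (- K * l) * exp (- b' * (T + 1)) \<le> C' * \<pi> u"
      using c(6)[of u] u T1 unfolding tau
      by (meson exp_ge_zero mult_left_mono order_trans)
    then have 2: "exp (- K * l) * exp (- b' * (T + 1)) / C' \<le> \<pi> u" using c by (simp add: field_simps)
    have "y = (1 + (T + 1)) powr (-1/2) * exp (x\<^sup>2 / 2 * (T / (1 + T))) * (exp (- K * l) * exp (- b' * (T + 1)) / C')"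
    proof -
      have "(1 + (T + 1)) powr (-1/2) = exp (- ln (2 + T) / 2)" using T1 by (simp add: powr_def add.commute)
      moreover have "1 / C' = exp (- ln C')" using c by (simp add: exp_minus inverse_eq_divide)
      ultimately show ?thesis unfolding y_def
        by (subst divide_inverse) (simp only: inverse_eq_divide exp_add[symmetric], simp add: algebra_simps)
    qed
    also have "\<dots> \<le> weight x u * \<pi> u"
      using c by (intro mult_mono[OF 1 2] weight_nonneg) auto
    finally show "y \<le> weight x u * \<pi> u" .
  qed (use T1 in auto)
  moreover have "q * exp (x\<^sup>2 / 2 * (u0 / (1 + u0))) \<le> y"
  proof -
    \<comment> \<open>\<open>S\<close> is the price per unit of T: 3/2 covers T/2 for the exponent
      lost at u = T and T for ln(2+T)/2; the other terms cover b'(T+1), ln C' and ln q. Constants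
      are absorbed by T \<ge> 1.\<close>
    define S where "S = 3 / 2 + 2 * b' + \<bar>ln C'\<bar> + \<bar>ln q\<bar>"
    have x2: "x\<^sup>2 = T\<^sup>2" by (simp add: T_def)
    \<comment> \<open>As T - A \<ge> C1, the excess of T^2 over A^2 is at least linear in T with
      slope C1. Division by 2(1+u0) turns A^2 into exactly K l.\<close>
    have "C1 * T \<le> (T - A) * (T + A)" using T A T1 C1 c by (intro mult_mono) auto
    then have "2 * (1 + u0) * S * T \<le> T\<^sup>2 - A\<^sup>2"
      using C1(2) T1 mult_right_mono[OF C1(2), of T] unfolding S_def by (simp add: power2_eq_square algebra_simps)
    then have "S * T \<le> T\<^sup>2 / 2 / (1 + u0) - K * l"
      unfolding A(2) using c(5) by (simp add: field_simps)
    moreover have "T * (3 / 2) + 2 * b' * T + \<bar>ln C'\<bar> + \<bar>ln q\<bar> \<le> S * T"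
      using T1 mult_left_mono[of 1 T "\<bar>ln C'\<bar>"] mult_left_mono[of 1 T "\<bar>ln q\<bar>"] by (simp add: S_def algebra_simps)
    moreover have "b' * (T + 1) \<le> 2 * b' * T" using c T1 by (simp add: algebra_simps)
    moreover have "ln (2 + T) \<le> 1 + T" using ln_add_one_self_le_self[of "1 + T"] T1 by simp
    moreover have "T\<^sup>2 / 2 / (1 + T) \<le> T / 2" using T1 by (simp add: field_simps power2_eq_square)
    moreover have "T\<^sup>2 / 2 * (T / (1 + T)) = T\<^sup>2 / 2 - T\<^sup>2 / 2 / (1 + T)"
      "T\<^sup>2 / 2 * (u0 / (1 + u0)) = T\<^sup>2 / 2 - T\<^sup>2 / 2 / (1 + u0)"
      using T1 c(5) by (simp_all add: field_simps power2_eq_square)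
    ultimately have "ln q + x\<^sup>2 / 2 * (u0 / (1 + u0)) \<le> - ln (2 + T) / 2 + x\<^sup>2 / 2 * (T / (1 + T)) - K * l - b' * (T + 1) - ln C'"
      unfolding x2 using T1 by argo
    then have "exp (ln q + x\<^sup>2 / 2 * (u0 / (1 + u0))) \<le> y" unfolding y_def exp_le_cancel_iff .
    then show ?thesis using q by (simp add: exp_add)
  qed
  ultimately show ?thesis by simp
qed

text \<open>Moving from [u0, U] to [2U, 4U] raises the exponent by at least x^2/2 * \<delta>. The
  price does not depend on x: R^k twice for comparing L with L u0 at both places, the power factor
  at 4U, and exp(4bU) for the exponential decay of the prior.\<close>

lemma prior_weight_ge_middle:
  fixes x :: real
  assumes pd: "prior_density \<pi>" and L: "\<And>u. u > 0 \<Longrightarrow> \<pi> u = L u * exp (- b * u)" "unif_reg_varying L R u0"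
    and b: "b \<ge> 0" and k: "u0 \<le> U" "4 * U \<le> 2 ^ k * u0"
    and \<delta>: "\<delta> = 2 * U / (1 + 2 * U) - U / (1 + U)"
    and q: "q > 0" "q * (R ^ k)\<^sup>2 * (1 + 4 * U) powr (1/2) * exp (4 * b * U) \<le> exp (x\<^sup>2 / 2 * \<delta>)"
    and u: "u0 \<le> u" "u \<le> U"
  shows "q * U * (weight x u * \<pi> u) \<le> (\<integral>u. weight x u * (indicator {0<..} u * \<pi> u) \<partial>lborel)"
proof -
  have u0: "u0 > 0" "U > 0" using L(2) k by (auto simp: unif_reg_varying_def)
  have R: "R \<ge> 1" using unif_reg_varying_ge_1[OF L(2)] .
  have L0: "L u \<ge> 0" if "u \<ge> u0" for u
  proof -
    have "\<pi> u \<ge> 0" "\<pi> u = L u * exp (- b * u)" using pd L(1) u0 that by (auto simp: prior_density_def)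
    then show ?thesis by (metis exp_gt_zero zero_le_mult_iff not_less)
  qed
  note bnd = unif_reg_varying_bounds[OF L(2) L0]
  have Lp: "L u0 \<ge> 0" using L0 by simp
  define y where "y = (1 + 4 * U) powr (-1/2) * exp (x\<^sup>2 / 2 * (2 * U / (1 + 2 * U))) * (L u0 / R ^ k * exp (- b * (4 * U)))"
  have "(4 * U - 2 * U) * y \<le> (\<integral>u. weight x u * (indicator {0<..} u * \<pi> u) \<partial>lborel)"
  proof (rule prior_weight_ge[OF pd])
    fix u assume u: "2 * U \<le> u" "u \<le> 4 * U"
    have "L u0 / R ^ k \<le> L u" using u k u0 by (intro bnd) auto
    moreover have "exp (- b * (4 * U)) \<le> exp (- b * u)" using u b by (simp add: mult_left_mono)
    ultimately have "L u0 / R ^ k * exp (- b * (4 * U)) \<le> L u * exp (- b * u)"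
      using L0[of u] u k u0 by (intro mult_mono) auto
    then have "L u0 / R ^ k * exp (- b * (4 * U)) \<le> \<pi> u" using L(1)[of u] u u0 by simp
    moreover have "(1 + 4 * U) powr (-1/2) * exp (x\<^sup>2 / 2 * (2 * U / (1 + 2 * U))) \<le> weight x u"
      using u u0 by (intro weight_ge) auto
    ultimately show "y \<le> weight x u * \<pi> u" unfolding y_def
      using Lp R by (intro mult_mono weight_nonneg) auto
  qed (use u0 in auto)
  moreover have "q * U * (weight x u * \<pi> u) \<le> (4 * U - 2 * U) * y"
  proof -
    have "weight x u \<le> exp (x\<^sup>2 / 2 * (u / (1 + u)))" using weight_bounds[of u x] u u0 by linarith
    also have "u / (1 + u) \<le> U / (1 + U)" using u u0 by (simp add: field_simps)
    then have "exp (x\<^sup>2 / 2 * (u / (1 + u))) \<le> exp (x\<^sup>2 / 2 * (U / (1 + U)))"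
      by (simp add: mult_left_mono del: times_divide_eq_left times_divide_eq_right)
    finally have w: "weight x u \<le> exp (x\<^sup>2 / 2 * (U / (1 + U)))" .
    have "U \<le> 2 ^ k * u0" using k u0 by simp
    then have "L u \<le> R ^ k * L u0" using u k by (intro bnd) auto
    moreover have "exp (- b * u) \<le> 1" using b u u0 by simp
    ultimately have "L u * exp (- b * u) \<le> R ^ k * L u0 * 1"
      using L0[of u] u R Lp by (intro mult_mono) auto
    then have "\<pi> u \<le> R ^ k * L u0" using L(1)[of u] u u0 by simp
    then have "weight x u * \<pi> u \<le> exp (x\<^sup>2 / 2 * (U / (1 + U))) * (R ^ k * L u0)"
      using pd u u0 w by (intro mult_mono) (auto simp: prior_density_def)
    then have "q * U * (weight x u * \<pi> u) \<le> q * U * (exp (x\<^sup>2 / 2 * (U / (1 + U))) * (R ^ k * L u0))"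
      using q u0 by (intro mult_left_mono) auto
    \<comment> \<open>Regrouped so that the first parenthesis is the quantity which the assumption
      on x bounds by exp(x^2/2 * \<delta>).\<close>
    also have "\<dots> = (q * (R ^ k)\<^sup>2 * (1 + 4 * U) powr (1/2) * exp (4 * b * U)) *
        (exp (x\<^sup>2 / 2 * (U / (1 + U))) * U * (1 + 4 * U) powr (-1/2) * (L u0 / R ^ k * exp (- b * (4 * U))))"
      using R u0 by (simp add: powr_minus exp_minus field_simps power2_eq_square)
    also have "\<dots> \<le> exp (x\<^sup>2 / 2 * \<delta>) *
        (exp (x\<^sup>2 / 2 * (U / (1 + U))) * U * (1 + 4 * U) powr (-1/2) * (L u0 / R ^ k * exp (- b * (4 * U))))"
      using Lp R u0 by (intro mult_right_mono q) auto
    also have "exp (x\<^sup>2 / 2 * (2 * U / (1 + 2 * U))) = exp (x\<^sup>2 / 2 * \<delta>) * exp (x\<^sup>2 / 2 * (U / (1 + U)))"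
      unfolding exp_add[symmetric] \<delta> by (simp add: algebra_simps)
    then have "exp (x\<^sup>2 / 2 * \<delta>) *
        (exp (x\<^sup>2 / 2 * (U / (1 + U))) * U * (1 + 4 * U) powr (-1/2) * (L u0 / R ^ k * exp (- b * (4 * U)))) = U * y"
      unfolding y_def by simp
    also have "U * y \<le> (4 * U - 2 * U) * y"
      using u0 Lp R by (intro mult_right_mono) (auto simp: y_def)
    finally show ?thesis .
  qed
  ultimately show ?thesis by linarith
qed

text \<open>The constant is fixed before the prior, n, p and K, so one value serves for every prior
  that the data may select.\<close>

lemma m_post_gt:
  fixes \<alpha> ustar u0 R b b' C' :: real
  assumes \<alpha>: "\<alpha> < 1"
  shows "\<exists>C1. \<forall>\<pi> n p K x. prior_density \<pi> \<longrightarrow> cond1 \<pi> n p b R u0 C' b' K ustar \<longrightarrow> 0 < p \<longrightarrow> p \<le> real n \<longrightarrow>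
     \<bar>x\<bar> \<ge> C1 + sqrt (2 * K * (u0 + 1) * ln (real n / p)) \<longrightarrow> m_post \<pi> x > \<alpha>"
\<comment> \<open>Outside these sign conditions \<open>cond1\<close> is contradictory and any
  constant will do.\<close>
proof (cases "u0 > 0 \<and> b \<ge> 0 \<and> C' > 0 \<and> b' > 0 \<and> ustar \<ge> 1 \<and> R > 0")
  case False
  then show ?thesis by (auto simp: cond1_def unif_reg_varying_def)
next
  case True
  then have c: "u0 > 0" "b \<ge> 0" "C' > 0" "b' > 0" "ustar \<ge> 1" "R > 0" by auto
  define q where "q = 4 / (1 - \<alpha>)"
  have q: "q > 0" using \<alpha> by (simp add: q_def)
  \<comment> \<open>Large enough that 1/(1+U) \<le> (1-\<alpha>)/4, which settles the range u >
    U.\<close>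
  define U where "U = max u0 q"
  have U: "U \<ge> u0" "U \<ge> q" "U > 0" using c by (auto simp: U_def)
  obtain k where k0: "4 * U / u0 < 2 ^ k" using real_arch_pow[of 2 "4 * U / u0"] by auto
  have k: "4 * U \<le> 2 ^ k * u0" using k0 c(1) by (simp add: field_simps)
  define \<delta> where "\<delta> = 2 * U / (1 + 2 * U) - U / (1 + U)"
  have "\<delta> = U / ((1 + U) * (1 + 2 * U))" using U(3) by (simp add: \<delta>_def divide_simps) (simp add: algebra_simps)
  then have \<delta>: "\<delta> > 0" using U(3) by simp
  define Q where "Q = q * (R ^ k)\<^sup>2 * (1 + 4 * U) powr (1/2) * exp (4 * b * U)"
  \<comment> \<open>The first two entries are what the comparison with [|x|, |x|+1] asks for. The
    third ensures Q \<le> x^2/2 * \<delta>, hence Q \<le> exp(x^2/2 * \<delta>), because x^2 \<ge>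
    C1 once |x| \<ge> C1 \<ge> 1.\<close>
  define C1 where "C1 = Max {ustar, 2 * (1 + u0) * (3 / 2 + 2 * b' + \<bar>ln C'\<bar> + \<bar>ln q\<bar>), 2 * Q / \<delta>}"
  have C1: "C1 \<ge> ustar" "C1 \<ge> 2 * (1 + u0) * (3 / 2 + 2 * b' + \<bar>ln C'\<bar> + \<bar>ln q\<bar>)" "C1 \<ge> 2 * Q / \<delta>"
    by (auto simp: C1_def)
  show ?thesis
  proof (intro exI[of _ C1] allI impI)
    fix \<pi> n p K x
    assume pd: "prior_density \<pi>" and c1: "cond1 \<pi> n p b R u0 C' b' K ustar" and p: "0 < p" "p \<le> real n"
      and x: "\<bar>x\<bar> \<ge> C1 + sqrt (2 * K * (u0 + 1) * ln (real n / p))"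
    obtain L where L: "\<And>u. u > 0 \<Longrightarrow> \<pi> u = L u * exp (- b * u)" "unif_reg_varying L R u0" and K: "K \<ge> 0"
      using c1 by (auto simp: cond1_def)
    have "sqrt (2 * K * (u0 + 1) * ln (real n / p)) \<ge> 0" using K c p by simp
    then have xC: "\<bar>x\<bar> \<ge> C1" using x by linarith
    have C11: "C1 \<ge> 1" using C1 c by simp
    have "C1 * 1 \<le> \<bar>x\<bar> * \<bar>x\<bar>" using xC C11 by (intro mult_mono) auto
    then have "C1 \<le> x\<^sup>2" by (simp add: power2_eq_square)
    then have "2 * Q / \<delta> \<le> x\<^sup>2" using C1 by simp
    then have "Q \<le> x\<^sup>2 / 2 * \<delta>" using \<delta> by (simp add: field_simps)
    also have "\<dots> \<le> exp (x\<^sup>2 / 2 * \<delta>)" using exp_ge_add_one_self[of "x\<^sup>2 / 2 * \<delta>"] by linarith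
    finally have Q: "Q \<le> exp (x\<^sup>2 / 2 * \<delta>)" .
    show "m_post \<pi> x > \<alpha>"
    proof (rule m_post_gt_criterion[OF pd c(1) U(1) _ \<alpha> refl])
      show "4 / (1 - \<alpha>) \<le> 1 + U" using U by (simp add: q_def)
      show "4 / (1 - \<alpha>) * exp (x\<^sup>2 / 2 * (u0 / (1 + u0))) \<le> (\<integral>u. weight x u * (indicator {0<..} u * \<pi> u) \<partial>lborel)"
        unfolding q_def[symmetric] by (rule prior_weight_ge_tail[OF pd c1 p x C1(1,2) q])
      show "4 / (1 - \<alpha>) * U * (weight x u * \<pi> u) \<le> (\<integral>u. weight x u * (indicator {0<..} u * \<pi> u) \<partial>lborel)"
        if "u0 \<le> u" "u \<le> U" for u
        unfolding q_def[symmetric]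
        by (rule prior_weight_ge_middle[OF pd L c(2) U(1) k \<delta>_def q Q[unfolded Q_def] that])
    qed
  qed
qed

section \<open>Upper bound for the shrinkage weight\<close>

lemma prior_set_integral:
  fixes g \<pi> :: "real \<Rightarrow> real"
  assumes "S \<subseteq> {0<..}"
  shows "(\<integral>u\<in>S. g u * \<pi> u \<partial>lborel) = (\<integral>u. indicator S u * g u * (indicator {0<..} u * \<pi> u) \<partial>lborel)"
  unfolding set_lebesgue_integral_def
  using assms by (intro Bochner_Integration.integral_cong) (auto simp: indicator_def)

lemma prior_integral_nonneg:
  assumes "prior_density \<pi>" "\<And>u. u > 0 \<Longrightarrow> 0 \<le> g u"
  shows "0 \<le> (\<integral>u. g u * (indicator {0<..} u * \<pi> u) \<partial>lborel)"
  using assms by (intro integral_nonneg_AE AE_I2) (auto simp: indicator_def prior_density_def)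

text \<open>The left side of Condition 3 is a sum of nonnegative terms. This disposes of negative C
  in the final proof.\<close>

lemma cond3_const_nonneg:
  assumes pd: "prior_density \<pi>" and c3: "cond3 \<pi> n p C" and \<nu>: "nu_n n p \<ge> 0" and s: "s_n n p > 0"
  shows "C \<ge> 0"
proof -
  have "0 \<le> (\<integral>u\<in>{s_n n p..}. min u ((nu_n n p) ^ 3 / sqrt u) * \<pi> u \<partial>lborel)"
    using s \<nu> by (subst prior_set_integral) (auto intro!: prior_integral_nonneg[OF pd])
  moreover have "0 \<le> (\<integral>u\<in>{1..(nu_n n p)\<^sup>2}. 1 / sqrt u * \<pi> u \<partial>lborel)"
    by (subst prior_set_integral) (auto intro!: prior_integral_nonneg[OF pd] simp del: times_divide_eq_left times_divide_eq_right)
  ultimately have "0 \<le> C * s_n n p" using c3 \<nu> by (simp add: cond3_def)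
     (meson add_nonneg_nonneg mult_nonneg_nonneg order_trans)
  then show ?thesis using s by (simp add: zero_le_mult_iff)
qed

text \<open>On (0, 1] the weight is at least 2^(-1/2), since 1 + u \<le> 2 and the exponent is
  nonnegative; Condition 2 supplies the mass there.\<close>

lemma cond2_weight_ge:
  assumes pd: "prior_density \<pi>" and c2: "cond2 \<pi> c"
  shows "c / sqrt 2 \<le> (\<integral>u. weight x u * (indicator {0<..} u * \<pi> u) \<partial>lborel)"
proof -
  have "c / sqrt 2 \<le> (\<integral>u\<in>{0<..1}. \<pi> u \<partial>lborel) / sqrt 2"
    using c2 by (auto simp: cond2_def intro!: divide_right_mono)
  also have "\<dots> = (\<integral>u. indicator {0<..1} u * (1 / sqrt 2) * (indicator {0<..} u * \<pi> u) \<partial>lborel)"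
    by (subst prior_set_integral[symmetric]) auto
  also have "\<dots> \<le> (\<integral>u. weight x u * (indicator {0<..} u * \<pi> u) \<partial>lborel)"
  proof (rule integral_mono[OF _ prior_weight_integrable[OF pd]])
    show "integrable lborel (\<lambda>u. indicator {0<..1} u * (1 / sqrt 2) * (indicator {0<..} u * \<pi> u))"
      by (rule prior_integrable[OF pd, of _ "1 / sqrt 2"]) (auto simp: indicator_def)
    show "indicator {0<..1} u * (1 / sqrt 2) * (indicator {0<..} u * \<pi> u) \<le> weight x u * (indicator {0<..} u * \<pi> u)" for u
    proof (rule mult_right_mono[OF _ prior_nonneg[OF pd]])
      show "indicator {0<..1} u * (1 / sqrt 2) \<le> weight x u"
      proof (cases "u \<in> {0<..1}")
        case True
        have "1 / sqrt 2 = (1 + 1) powr (-1/2) * exp 0" by (simp add: powr_minus powr_half_sqrt inverse_eq_divide)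
        also have "\<dots> \<le> weight x u" unfolding weight_def
          using True by (intro mult_mono powr_mono2') auto
        finally show ?thesis using True by simp
      qed (simp add: weight_nonneg)
    qed
  qed
  finally show ?thesis .
qed

text \<open>The denominator is at least c/sqrt 2. The numerator is cut at s, 1 and v^2, where s =
  \<open>s_n n p\<close> and v = \<open>nu_n n p\<close>: below s both factors are trivial, on [s,
  1) the inequality u/(1+u) \<le> 1/2 halves the exponent, and above 1 the power factor gives 1/sqrt
  u. Condition 3 controls precisely the resulting integrals.\<close>

lemma m_post_le:
  assumes pd: "prior_density \<pi>" and c2: "cond2 \<pi> c" and c3: "cond3 \<pi> n p C"
    and \<nu>: "nu_n n p \<ge> 1" and s: "s_n n p > 0" "s_n n p \<le> 1"
  shows "m_post \<pi> x \<le> sqrt 2 / c * (s_n n p * exp (x\<^sup>2 / 2 * s_n n p) + C * s_n n p * exp (x\<^sup>2 / 4)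
     + C * (s_n n p / nu_n n p) * exp (x\<^sup>2 / 2))"
proof -
  define s where "s = s_n n p"
  define v where "v = nu_n n p"
  have sv: "s > 0" "s \<le> 1" "v \<ge> 1" using assms by (auto simp: s_def v_def)
  have c: "c > 0" using c2 by (simp add: cond2_def)
  let ?f = "\<lambda>u. indicator {0<..} u * \<pi> u"
  define N where "N = (\<integral>u. u / (1 + u) * weight x u * ?f u \<partial>lborel)"
  define D where "D = (\<integral>u. weight x u * ?f u \<partial>lborel)"
  \<comment> \<open>\<open>h\<close> and \<open>g\<close> are the two kernels of Condition 3. The
    minimum in \<open>h\<close> changes branch at u = v^2, so beyond v^2 the function 1/sqrt u
    equals h/v^3.\<close>
  define h where "h = (\<lambda>u. indicator {s..} u * min u (v ^ 3 / sqrt u))"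
  define g where "g = (\<lambda>u. indicator {1..v\<^sup>2} u * (1 / sqrt u))"
  define J1 where "J1 = (\<integral>u. h u * ?f u \<partial>lborel)"
  define J2 where "J2 = (\<integral>u. g u * ?f u \<partial>lborel)"
  have J1: "J1 = (\<integral>u\<in>{s..}. min u (v ^ 3 / sqrt u) * \<pi> u \<partial>lborel)"
    using sv by (subst prior_set_integral) (auto simp: J1_def h_def)
  have J2: "J2 = (\<integral>u\<in>{1..v\<^sup>2}. 1 / sqrt u * \<pi> u \<partial>lborel)"
    by (subst prior_set_integral) (auto simp: J2_def g_def)
  have J: "J1 + v * J2 \<le> C * s" using c3 unfolding cond3_def J1 J2 s_def v_def by simp
  have h0: "0 \<le> h u" if "u > 0" for u using that sv by (auto simp: h_def)
  have g0: "0 \<le> g u" for u by (auto simp: g_def indicator_def)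
  have J0: "J1 \<ge> 0" "J2 \<ge> 0" unfolding J1_def J2_def
    using h0 g0 by (auto intro!: prior_integral_nonneg[OF pd])
  have ih: "integrable lborel (\<lambda>u. h u * ?f u)"
  proof (rule prior_integrable[OF pd, of _ "v ^ 3 / sqrt s"])
    fix u :: real assume "u > 0"
    show "\<bar>h u\<bar> \<le> v ^ 3 / sqrt s"
    proof (cases "s \<le> u")
      case True
      have "h u \<le> v ^ 3 / sqrt u" using True by (simp add: h_def)
      also have "\<dots> \<le> v ^ 3 / sqrt s" using True sv by (intro divide_left_mono) auto
      finally show ?thesis using h0[OF \<open>u > 0\<close>] by simp
    next
      case False then show ?thesis using sv by (simp add: h_def)
    qed
  qed (simp add: h_def)
  have ig: "integrable lborel (\<lambda>u. g u * ?f u)"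
  proof (rule prior_integrable[OF pd, of _ 1])
    show "\<bar>g u\<bar> \<le> 1" for u by (auto simp: g_def indicator_def)
  qed (simp add: g_def)
  have if': "integrable lborel ?f" using pd by (simp add: prior_density_def set_integrable_def)
  have iN: "integrable lborel (\<lambda>u. u / (1 + u) * weight x u * ?f u)"
    by (rule prior_shrunk_weight_integrable[OF pd])
  let ?Es = "exp (x\<^sup>2 / 2 * s)" and ?E4 = "exp (x\<^sup>2 / 4)" and ?E2 = "exp (x\<^sup>2 / 2)"
  have pw: "u / (1 + u) * weight x u \<le> s * ?Es + (?E4 + ?E2 / v ^ 3) * h u + ?E2 * g u" if u: "u > 0" for u
  proof -
    have w: "0 \<le> weight x u" "weight x u \<le> exp (x\<^sup>2 / 2 * (u / (1 + u)))" "weight x u \<le> ?E2"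
      using weight_bounds[OF u, of x] weight_bound[OF u, of x] weight_nonneg by auto
    have uu: "u / (1 + u) \<le> u" "0 \<le> u / (1 + u)" "u / (1 + u) \<le> 1" using u by (auto simp: field_simps)
    have nn: "0 \<le> s * ?Es" "0 \<le> ?E4 * h u" "0 \<le> ?E2 / v ^ 3 * h u" "0 \<le> ?E2 * g u"
      using sv h0[OF u] g0 by auto
    have tail: "u / (1 + u) * weight x u \<le> 1 / sqrt u * ?E2" if "u \<ge> 1"
    proof -
      have "x\<^sup>2 / 2 * (u / (1 + u)) \<le> x\<^sup>2 / 2" using uu by (intro mult_left_le) auto
      moreover have "(1 + u) powr (-1/2) \<le> u powr (-1/2)" using u by (intro powr_mono2') auto
      moreover have "u powr (-1/2) = 1 / sqrt u" using u by (simp add: powr_minus powr_half_sqrt inverse_eq_divide)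
      ultimately have "weight x u \<le> 1 / sqrt u * ?E2" using u unfolding weight_def by (intro mult_mono) auto
      moreover have "u / (1 + u) * weight x u \<le> 1 * weight x u" using uu w by (intro mult_right_mono) auto
      ultimately show ?thesis by simp
    qed
    consider "u < s" | "s \<le> u" "u < 1" | "1 \<le> u" "u \<le> v\<^sup>2" | "1 \<le> u" "v\<^sup>2 < u" by linarith
    then show ?thesis
    proof cases
      case 1
      have "x\<^sup>2 / 2 * (u / (1 + u)) \<le> x\<^sup>2 / 2 * s" using uu 1 by (intro mult_left_mono) auto
      then have "weight x u \<le> ?Es" using w by (meson exp_le_cancel_iff order_trans)
      then have "u / (1 + u) * weight x u \<le> s * ?Es" using uu w 1 sv by (intro mult_mono) auto
      then show ?thesis using nn unfolding distrib_right by linarith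
    next
      case 2
      have "u / (1 + u) \<le> 1 / 2" using u 2 by (simp add: field_simps)
      then have "x\<^sup>2 / 2 * (u / (1 + u)) \<le> x\<^sup>2 / 2 * (1 / 2)" by (intro mult_left_mono) auto
      then have "exp (x\<^sup>2 / 2 * (u / (1 + u))) \<le> ?E4" by (subst exp_le_cancel_iff) simp
      then have "weight x u \<le> ?E4" using w by linarith
      then have "u / (1 + u) * weight x u \<le> u * ?E4" using uu w u by (intro mult_mono) auto
      moreover have "u \<le> v ^ 3 / sqrt u"
      proof -
        have "u \<le> 1 / sqrt u" using u 2 by (simp add: field_simps mult_le_one)
        also have "\<dots> \<le> v ^ 3 / sqrt u" using sv u by (intro divide_right_mono) auto
        finally show ?thesis .
      qed
      then have "h u = u" using 2 by (simp add: h_def)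
      ultimately show ?thesis using nn unfolding distrib_right by (simp add: mult.commute)
    next
      case 3
      have "u / (1 + u) * weight x u \<le> 1 / sqrt u * ?E2"
        by (rule tail) (use u 3 in auto)
      moreover have "g u = 1 / sqrt u" using 3 by (simp add: g_def)
      ultimately show ?thesis using nn unfolding distrib_right by (simp add: mult.commute)
    next
      case 4
      have "u / (1 + u) * weight x u \<le> 1 / sqrt u * ?E2"
        by (rule tail) (use u 4 in auto)
      moreover have "h u = v ^ 3 / sqrt u"
      proof -
        have "v = sqrt (v\<^sup>2)" using sv by simp
        also have "\<dots> \<le> sqrt u" using 4 by (intro real_sqrt_le_mono) simp
        finally have "v ^ 3 \<le> sqrt u ^ 3" using sv by (intro power_mono) auto
        also have "\<dots> = u * sqrt u" using u by (simp add: power3_eq_cube)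
        finally have "v ^ 3 / sqrt u \<le> u" using u by (simp add: field_simps)
        then show ?thesis using 4 sv by (simp add: h_def)
      qed
      then have "?E2 / v ^ 3 * h u = 1 / sqrt u * ?E2" using sv by simp
      ultimately show ?thesis using nn unfolding distrib_right by linarith
    qed
  qed
  have "N \<le> (\<integral>u. s * ?Es * ?f u + (?E4 + ?E2 / v ^ 3) * (h u * ?f u) + ?E2 * (g u * ?f u) \<partial>lborel)"
    unfolding N_def
  proof (rule integral_mono[OF iN])
    show "integrable lborel (\<lambda>u. s * ?Es * ?f u + (?E4 + ?E2 / v ^ 3) * (h u * ?f u) + ?E2 * (g u * ?f u))"
      by (intro Bochner_Integration.integrable_add integrable_mult_right ih ig if')
    show "u / (1 + u) * weight x u * ?f u \<le> s * ?Es * ?f u + (?E4 + ?E2 / v ^ 3) * (h u * ?f u) + ?E2 * (g u * ?f u)" for u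
    proof (cases "u > 0")
      case True
      from mult_right_mono[OF pw[OF True] prior_nonneg[OF pd, of u]] show ?thesis by (simp only: distrib_right mult.assoc)
    qed simp
  qed
  also have "\<dots> = s * ?Es + (?E4 + ?E2 / v ^ 3) * J1 + ?E2 * J2"
    using ih ig if' prior_integral[OF pd] by (simp add: J1_def J2_def)
  also have "\<dots> = s * ?Es + ?E4 * J1 + ?E2 * (J1 / v ^ 3 + J2)" by (simp add: algebra_simps)
  also have "\<dots> \<le> s * ?Es + ?E4 * (C * s) + ?E2 * (C * (s / v))"
  proof (intro add_mono mult_left_mono)
    show "J1 \<le> C * s" using J J0 sv by (smt (verit) mult_nonneg_nonneg)
    \<comment> \<open>Weakening 1/v^3 to 1/v makes the combination a multiple of J1 + v J2, the very
      sum that Condition 3 bounds.\<close>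
    have "v \<le> v ^ 3" using sv by (simp add: self_le_power)
    then have "J1 / v ^ 3 \<le> J1 / v" using J0 sv by (intro divide_left_mono) auto
    then have "J1 / v ^ 3 + J2 \<le> (J1 + v * J2) / v" using sv by (simp add: field_simps)
    also have "\<dots> \<le> C * s / v" using J sv by (intro divide_right_mono) auto
    finally show "J1 / v ^ 3 + J2 \<le> C * (s / v)" by simp
  qed (use sv in auto)
  finally have N: "N \<le> s * ?Es + C * s * ?E4 + C * (s / v) * ?E2" by (simp add: mult_ac)
  have N0: "0 \<le> N" unfolding N_def using weight_nonneg by (intro prior_integral_nonneg[OF pd]) auto
  have Dc: "c / sqrt 2 \<le> D" unfolding D_def by (rule cond2_weight_ge[OF pd c2])
  have "N / D \<le> N / (c / sqrt 2)" using Dc c N0 by (intro divide_left_mono mult_pos_pos) (auto intro: less_le_trans[of _ "c / sqrt 2"])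
  also have "\<dots> = sqrt 2 / c * N" by simp
  also have "\<dots> \<le> sqrt 2 / c * (s * ?Es + C * s * ?E4 + C * (s / v) * ?E2)"
    using N c by (intro mult_left_mono) auto
  finally show ?thesis unfolding m_post_weight N_def D_def s_def v_def .
qed

section \<open>Choice of the threshold\<close>

text \<open>From ln(t/a) \<le> t/a - 1 one gets a ln(1/a) \<le> a ln(1/t) + (t - a), and ln(1/t)
  \<ge> 1 on (0, 1/e]. This carries bounds from a deterministic level t to every p/n below
  it.\<close>

lemma mult_ln_inverse_mono:
  fixes a t :: real
  assumes "0 < a" "a \<le> t" "t \<le> exp (-1)"
  shows "a * ln (1 / a) \<le> t * ln (1 / t)"
proof -
  have t: "ln (1 / t) \<ge> 1" using assms ln_mono[of t "exp (-1)"] by (simp add: ln_div)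
  have "ln (1 / a) = ln (1 / t) + ln (t / a)" using assms by (simp add: ln_div)
  also have "ln (t / a) \<le> t / a - 1" using assms by (intro ln_le_minus_one) auto
  finally have "a * ln (1 / a) \<le> a * (ln (1 / t) + (t / a - 1))" using assms by simp
  also have "\<dots> = a * ln (1 / t) + (t - a) * 1" using assms by (simp add: field_simps)
  also have "\<dots> \<le> a * ln (1 / t) + (t - a) * ln (1 / t)" using assms t by (intro add_left_mono mult_left_mono) auto
  finally show ?thesis by (simp add: algebra_simps)
qed

text \<open>The square is the product of a and a ln(1/a), both increasing on (0, 1/e].\<close>

lemma mult_sqrt_ln_inverse_mono:
  fixes a t :: real
  assumes "0 < a" "a \<le> t" "t \<le> exp (-1)"
  shows "a * sqrt (ln (1 / a)) \<le> t * sqrt (ln (1 / t))"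
proof -
  have e: "t < 1" using assms by (meson exp_less_one_iff le_less_trans neg_less_0_iff_less zero_less_one)
  have *: "b * sqrt (ln (1 / b)) = sqrt (b * (b * ln (1 / b)))" if "b > 0" for b :: real
    using that by (simp add: real_sqrt_mult)
  have "sqrt (a * (a * ln (1 / a))) \<le> sqrt (t * (t * ln (1 / t)))"
    using assms e by (intro real_sqrt_le_mono mult_mono[OF _ mult_ln_inverse_mono[OF assms]] mult_nonneg_nonneg) auto
  then show ?thesis using assms by (simp add: *)
qed

text \<open>W stands for T^2/2 and t for the upper bound of p/n. By the choice of W the last term of
  the bound on m_x is the constant C B, and B is such that it contributes \<alpha>/sqrt 2 <
  \<alpha>; the two other terms vanish as t tends to 0. The clause ln(1/t) \<le> 2W makes T at least
  sqrt(ln(1/t)), as the tail bound requires.\<close>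

lemma eventually_threshold:
  fixes \<alpha> c C :: real
  assumes pos: "\<alpha> > 0" "c > 0" "C > 0" and B: "B = \<alpha> * c / (2 * C)"
  shows "eventually (\<lambda>t. let W = ln (B / (t * sqrt (ln (1 / t)))) in
     0 < t \<and> t \<le> exp (-1) \<and> t * ln (1 / t) \<le> 1 \<and> ln (1 / t) \<le> 2 * W \<and>
     sqrt 2 / c * (t * ln (1 / t) * exp (W * (t * ln (1 / t))) + C * (t * ln (1 / t)) * exp (W / 2)
       + C * (t * sqrt (ln (1 / t))) * exp W) \<le> \<alpha>) (at_right 0)"
proof -
  have B0: "B > 0" using pos by (simp add: B)
  define W where "W = (\<lambda>t::real. ln (B / (t * sqrt (ln (1 / t)))))"
  have "((\<lambda>t. sqrt 2 / c * (t * ln (1 / t) * exp (W t * (t * ln (1 / t))) + C * (t * ln (1 / t)) * exp (W t / 2) + C * B))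
     \<longlongrightarrow> sqrt 2 / c * (0 + 0 + C * B)) (at_right 0)"
  proof (intro tendsto_intros)
    show "((\<lambda>t. t * ln (1 / t) * exp (W t * (t * ln (1 / t)))) \<longlongrightarrow> 0) (at_right 0)"
      using B0 unfolding W_def by real_asymp
    show "((\<lambda>t. C * (t * ln (1 / t)) * exp (W t / 2)) \<longlongrightarrow> 0) (at_right 0)"
      using B0 unfolding W_def by real_asymp
  qed
  moreover have "sqrt 2 / c * (0 + 0 + C * B) < \<alpha>"
  proof -
    have "sqrt 2 / c * (0 + 0 + C * B) = \<alpha> * (sqrt 2 / 2)" using pos by (simp add: B)
    also have "\<dots> < \<alpha> * 1" using pos sqrt2_less_2 by (intro mult_strict_left_mono) auto
    finally show ?thesis by simp
  qed
  ultimately have ev1: "eventually (\<lambda>t. sqrt 2 / c * (t * ln (1 / t) * exp (W t * (t * ln (1 / t))) + C * (t * ln (1 / t)) * exp (W t / 2) + C * B) < \<alpha>) (at_right 0)"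
    by (rule order_tendstoD)
  have ev2: "eventually (\<lambda>t. ln (1 / t) \<le> 2 * W t) (at_right 0)"
    using B0 unfolding W_def by real_asymp
  have ev3: "eventually (\<lambda>t::real. t * ln (1 / t) \<le> 1) (at_right 0)" by real_asymp
  have ev4: "eventually (\<lambda>t::real. 0 < t \<and> t < exp (-1)) (at_right 0)"
    by (intro eventually_conj eventually_at_right_less order_tendstoD[OF tendsto_ident_at]) auto
  show ?thesis using ev1 ev2 ev3 ev4
  proof eventually_elim
    case (elim t)
    have "t < 1" using elim(4) by (meson exp_less_one_iff less_trans neg_less_0_iff_less zero_less_one)
    then have p: "t * sqrt (ln (1 / t)) > 0" using elim(4) by simp
    have Wt: "ln (B / (t * sqrt (ln (1 / t)))) = W t" by (simp add: W_def)
    have "exp (W t) = B / (t * sqrt (ln (1 / t)))" using B0 p by (simp only: W_def exp_ln divide_pos_pos)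
    then have CB: "C * (t * sqrt (ln (1 / t))) * exp (W t) = C * B"
      using p by (simp only: mult.assoc nonzero_mult_div_cancel_left less_imp_neq[symmetric]) (use p in force)
    show ?case unfolding Let_def Wt CB using elim by linarith
  qed
qed

section \<open>The Gaussian sequence model\<close>

abbreviation gauss :: "real \<Rightarrow> real measure" where
  "gauss \<mu> \<equiv> density lborel (normal_density \<mu> 1)"

lemma prob_space_gauss: "prob_space (gauss \<mu>)"
  by (rule prob_space_normal_density) simp

lemma prob_space_gauss_model: "prob_space (gauss_model n \<theta>)"
  unfolding gauss_model_def by (intro prob_space_PiM prob_space_gauss)

lemma space_gauss_model: "space (gauss_model n \<theta>) = (\<Pi>\<^sub>E i\<in>{..<n}. UNIV)"
  by (simp add: gauss_model_def space_PiM)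

lemma sets_gauss_model: "sets (gauss_model n \<theta>) = sets (PiM {..<n} (\<lambda>_. lborel))"
  unfolding gauss_model_def by (intro sets_PiM_cong) auto

lemma gauss_model_component_measurable:
  assumes "i < n" "A \<in> sets borel"
  shows "{X \<in> space (gauss_model n \<theta>). X i \<in> A} \<in> sets (gauss_model n \<theta>)"
proof -
  have "(\<lambda>X. X i) \<in> measurable (gauss_model n \<theta>) (gauss (\<theta> i))"
    unfolding gauss_model_def using assms by (intro measurable_component_singleton) auto
  then have "(\<lambda>X. X i) -` A \<inter> space (gauss_model n \<theta>) \<in> sets (gauss_model n \<theta>)"
    by (rule measurable_sets) (use assms in simp)
  then show ?thesis by (simp add: vimage_def Int_def conj_commute)
qed

lemma measure_gauss_model_component:
  assumes "i < n" "A \<in> sets borel"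
  shows "measure (gauss_model n \<theta>) {X \<in> space (gauss_model n \<theta>). X i \<in> A} = measure (gauss (\<theta> i)) A"
proof -
  have "measure (gauss (\<theta> i)) A = measure (distr (gauss_model n \<theta>) (gauss (\<theta> i)) (\<lambda>X. X i)) A"
    unfolding gauss_model_def using assms prob_space_gauss
    by (subst distr_PiM_component[where i=i]) auto
  also have "\<dots> = measure (gauss_model n \<theta>) ((\<lambda>X. X i) -` A \<inter> space (gauss_model n \<theta>))"
    using assms by (intro measure_distr) (auto simp: gauss_model_def)
  finally show ?thesis by (simp add: vimage_def Int_def conj_commute)
qed

section \<open>Normal distribution function and tail bounds\<close>

lemma measure_gauss:
  assumes "A \<in> sets borel"
  shows "measure (gauss \<mu>) A = (\<integral>x. normal_density \<mu> 1 x * indicator A x \<partial>lborel)"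
proof -
  have "measure (gauss \<mu>) A = (\<integral>x. indicator A x \<partial>gauss \<mu>)" using assms by simp
  also have "\<dots> = (\<integral>x. normal_density \<mu> 1 x * indicator A x \<partial>lborel)"
    using assms by (subst integral_density) auto
  finally show ?thesis .
qed

lemma Phi_eq_measure: "Phi x = measure (gauss 0) {..x}"
  unfolding Phi_def set_lebesgue_integral_def by (subst measure_gauss) (auto simp: mult.commute)

lemma measure_gauss_atMost: "measure (gauss \<mu>) {..a} = Phi (a - \<mu>)"
  unfolding Phi_eq_measure measure_gauss[OF borel_closed[OF closed_atMost]]
  by (subst lborel_integral_real_affine[of 1 _ \<mu>])
     (auto intro!: Bochner_Integration.integral_cong simp: normal_density_def indicator_def)

lemma measure_gauss_atLeast: "measure (gauss \<mu>) {a..} = Phi (\<mu> - a)"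
  unfolding Phi_eq_measure measure_gauss[OF borel_closed[OF closed_atMost]] measure_gauss[OF borel_closed[OF closed_atLeast]]
  by (subst lborel_integral_real_affine[of "-1" _ \<mu>])
     (auto intro!: Bochner_Integration.integral_cong simp: normal_density_def indicator_def)

lemma Phi_le_1: "Phi x \<le> 1"
  unfolding Phi_eq_measure by (rule prob_space.prob_le_1[OF prob_space_gauss])

lemma Phi_nonneg: "0 \<le> Phi x"
  unfolding Phi_eq_measure by simp

lemma Phi_at_bot: "(Phi \<longlongrightarrow> 0) at_bot"
proof -
  interpret prob_space "gauss 0" by (rule prob_space_gauss)
  interpret real_distribution "gauss 0" by unfold_locales simp_all
  have "Phi = cdf (gauss 0)" by (simp add: fun_eq_iff Phi_eq_measure cdf_def2)
  then show ?thesis using cdf_lim_at_bot by simp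
qed

text \<open>The event forces the noise to reach v in the direction of the origin, a one-sided event;
  the sign of \<mu> decides the side.\<close>

lemma measure_gauss_abs_less:
  "measure (gauss \<mu>) {x. \<bar>x\<bar> < \<bar>\<mu>\<bar> - v} \<le> Phi (- v)"
proof -
  interpret prob_space "gauss \<mu>" by (rule prob_space_gauss)
  show ?thesis
  proof (cases "\<mu> \<ge> 0")
    case True
    then have "{x. \<bar>x\<bar> < \<bar>\<mu>\<bar> - v} \<subseteq> {..\<mu> - v}" by auto
    then have "measure (gauss \<mu>) {x. \<bar>x\<bar> < \<bar>\<mu>\<bar> - v} \<le> measure (gauss \<mu>) {..\<mu> - v}"
      by (intro finite_measure_mono) auto
    then show ?thesis by (simp add: measure_gauss_atMost)
  next
    case False
    then have "{x. \<bar>x\<bar> < \<bar>\<mu>\<bar> - v} \<subseteq> {\<mu> + v..}" by auto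
    then have "measure (gauss \<mu>) {x. \<bar>x\<bar> < \<bar>\<mu>\<bar> - v} \<le> measure (gauss \<mu>) {\<mu> + v..}"
      by (intro finite_measure_mono) auto
    then show ?thesis by (simp add: measure_gauss_atLeast)
  qed
qed

text \<open>Mills' bound: on [T, \<infinity>) the extra factor x/T \<ge> 1 gives the density an
  explicit antiderivative.\<close>

lemma Phi_uminus_le:
  assumes T: "T > 0"
  shows "Phi (- T) \<le> exp (- T\<^sup>2 / 2) / (sqrt (2 * pi) * T)"
proof -
  let ?F = "\<lambda>x. - (exp (- x\<^sup>2 / 2) / (sqrt (2 * pi) * T))"
  have "emeasure (gauss 0) {T..} = (\<integral>\<^sup>+x. ennreal (std_normal_density x) * indicator {T..} x \<partial>lborel)"
    by (subst emeasure_density) auto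
  also have "\<dots> \<le> (\<integral>\<^sup>+x. ennreal (x / T * std_normal_density x) * indicator {T..} x \<partial>lborel)"
  proof (intro nn_integral_mono)
    fix x :: real
    have "std_normal_density x \<le> x / T * std_normal_density x" if "x \<ge> T"
      using T that mult_right_mono[of 1 "x / T" "std_normal_density x"] by simp
    then show "ennreal (std_normal_density x) * indicator {T..} x \<le> ennreal (x / T * std_normal_density x) * indicator {T..} x"
      by (auto simp: indicator_def intro!: ennreal_leI)
  qed
  also have "\<dots> = ennreal (0 - ?F T)"
  proof (rule nn_integral_FTC_atLeast[where F="?F" and T=0])
    show "(?F \<longlongrightarrow> 0) at_top" using T by real_asymp
    show "DERIV ?F x :> x / T * std_normal_density x" if "T \<le> x" for x
      using T by (auto intro!: derivative_eq_intros simp: std_normal_density_def field_simps)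
    show "0 \<le> x / T * std_normal_density x" if "T \<le> x" for x using T that by auto
  qed simp
  finally have "emeasure (gauss 0) {T..} \<le> ennreal (0 - ?F T)" .
  then have "measure (gauss 0) {T..} \<le> 0 - ?F T" unfolding measure_def
    using T by (intro enn2real_leI) auto
  then show ?thesis by (simp add: measure_gauss_atLeast)
qed

lemma measure_gauss_abs_greater:
  assumes T: "T > 0"
  shows "measure (gauss 0) {x. \<bar>x\<bar> > T} \<le> 2 * exp (- T\<^sup>2 / 2) / (sqrt (2 * pi) * T)"
proof -
  interpret prob_space "gauss 0" by (rule prob_space_gauss)
  have "{x. \<bar>x\<bar> > T} \<subseteq> {..-T} \<union> {T..}" by auto
  then have "measure (gauss 0) {x. \<bar>x\<bar> > T} \<le> measure (gauss 0) ({..-T} \<union> {T..})"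
    by (intro finite_measure_mono) auto
  also have "\<dots> \<le> measure (gauss 0) {..-T} + measure (gauss 0) {T..}"
    by (rule measure_Un_le) auto
  also have "\<dots> = 2 * Phi (- T)" by (simp add: measure_gauss_atLeast measure_gauss_atMost)
  finally show ?thesis using Phi_uminus_le[OF T] by simp
qed

section \<open>Risk of a threshold-dominated test\<close>

text \<open>After clearing denominators the gap between the sides is a(w - M)^2. The right side is
  affine in w, so its expectation needs the mean of w only.\<close>

lemma frac_le_tangent:
  fixes w a M :: real
  assumes "w \<ge> 0" "a > 0" "M \<ge> 0"
  shows "w / (w + a) \<le> M\<^sup>2 / (M + a)\<^sup>2 + a / (M + a)\<^sup>2 * w"
proof -
  have "w * (M + a)\<^sup>2 + a * (w - M)\<^sup>2 = (M\<^sup>2 + a * w) * (w + a)"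
    by (simp add: power2_eq_square algebra_simps)
  then have "w * (M + a)\<^sup>2 \<le> (M\<^sup>2 + a * w) * (w + a)" using assms by (smt (verit) mult_nonneg_nonneg zero_le_power2)
  then have "w / (w + a) \<le> (M\<^sup>2 + a * w) / (M + a)\<^sup>2"
    using assms by (simp add: pos_divide_le_eq pos_le_divide_eq)
  then show ?thesis by (simp add: add_divide_distrib)
qed

lemma S0_subset: "S0 n \<theta> \<subseteq> {..<n}" by (auto simp: S0_def)

text \<open>V/(V + S) increases with the false discoveries V and decreases with the true ones
  S.\<close>

lemma false_discovery_proportion_le:
  fixes \<xi> :: "nat \<Rightarrow> real"
  assumes \<xi>: "\<And>i. \<xi> i \<in> {0, 1}" and w: "(\<Sum>i\<in>{..<n} - S0 n \<theta>. \<xi> i) \<le> w"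
    and a: "0 < a" "a \<le> (\<Sum>i\<in>S0 n \<theta>. \<xi> i)"
  shows "(\<Sum>i\<in>{..<n} - S0 n \<theta>. \<xi> i) / max (\<Sum>i<n. \<xi> i) 1 \<le> w / (w + a)"
proof -
  define V where "V = (\<Sum>i\<in>{..<n} - S0 n \<theta>. \<xi> i)"
  define S where "S = (\<Sum>i\<in>S0 n \<theta>. \<xi> i)"
  have 01: "0 \<le> \<xi> i" for i using \<xi>[of i] by auto
  have V: "0 \<le> V" "V \<le> w" using w by (auto simp: V_def intro!: sum_nonneg 01)
  have "(\<Sum>i<n. \<xi> i) = V + S"
    unfolding V_def S_def using sum.subset_diff[OF S0_subset, of n \<xi> \<theta>] by simp
  then have "V / max (\<Sum>i<n. \<xi> i) 1 \<le> V / (V + a)"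
    using V a by (intro divide_left_mono mult_pos_pos) (auto simp: S_def)
  also have "\<dots> \<le> w / (w + a)" using V a by (simp add: field_simps)
  finally show ?thesis unfolding V_def .
qed

lemma false_discovery_proportion_le_1:
  fixes \<xi> :: "nat \<Rightarrow> real"
  assumes \<xi>: "\<And>i. \<xi> i \<in> {0, 1}"
  shows "(\<Sum>i\<in>{..<n} - S0 n \<theta>. \<xi> i) / max (\<Sum>i<n. \<xi> i) 1 \<le> 1"
proof -
  have 01: "0 \<le> \<xi> i" for i using \<xi>[of i] by auto
  have "(\<Sum>i\<in>{..<n} - S0 n \<theta>. \<xi> i) \<le> (\<Sum>i<n. \<xi> i)" using 01 by (intro sum_mono2) auto
  then show ?thesis by (subst divide_le_eq_1_pos) (auto simp: less_max_iff_disj le_max_iff_disj)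
qed

(* Xi need not be measurable: the Bochner integral of a non-measurable function is 0, and the
   integrable majorants below are nonnegative. *)
lemma Rsup_le:
  fixes Xi :: "(nat \<Rightarrow> real) \<Rightarrow> nat \<Rightarrow> real"
  assumes Xi: "\<And>X i. Xi X i \<in> {0, 1}"
    and G: "G \<in> sets (gauss_model n \<theta>)" "measure (gauss_model n \<theta>) G \<ge> 1 - \<delta>"
    and pn: "card (S0 n \<theta>) = pn" "pn > 0"
    and reject: "\<And>X i. X \<in> G \<Longrightarrow> i \<in> S0 n \<theta> \<Longrightarrow> \<bar>X i\<bar> \<ge> \<bar>\<theta> i\<bar> - v \<Longrightarrow> Xi X i = 1"
    and accept: "\<And>X i. X \<in> G \<Longrightarrow> i < n \<Longrightarrow> \<bar>X i\<bar> \<le> T \<Longrightarrow> Xi X i = 0"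
    and T: "T > 0" and M: "real n * (2 * exp (- T\<^sup>2 / 2) / (sqrt (2 * pi) * T)) \<le> M"
    and lam: "0 < lam" "lam < 1"
  shows "Rsup n \<theta> pn Xi \<le> M / (M + lam * real pn) + Phi (- v) + (2 * \<delta> + Phi (- v) / (1 - lam))"
proof -
  let ?P = "gauss_model n \<theta>"
  interpret prob_space ?P by (rule prob_space_gauss_model)
  define q where "q = 2 * exp (- T\<^sup>2 / 2) / (sqrt (2 * pi) * T)"
  have q0: "q \<ge> 0" using T by (simp add: q_def)
  have nq: "real n * q \<le> M" using M by (simp add: q_def)
  have M0: "M \<ge> 0" using nq q0 by (meson mult_nonneg_nonneg of_nat_0_le_iff order_trans)
  define a where "a = lam * real pn"
  have a: "a > 0" using lam pn by (simp add: a_def)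
  define B where "B = (\<lambda>i. {X \<in> space ?P. X i \<in> {x. \<bar>x\<bar> < \<bar>\<theta> i\<bar> - v}})"
  define W where "W = (\<lambda>i. {X \<in> space ?P. X i \<in> {x. \<bar>x\<bar> > T}})"
  have Bm: "B i \<in> sets ?P" if "i < n" for i unfolding B_def using that by (rule gauss_model_component_measurable) measurable
  have Wm: "W i \<in> sets ?P" if "i < n" for i unfolding W_def using that by (rule gauss_model_component_measurable) measurable
  have PB: "measure ?P (B i) \<le> Phi (- v)" if "i < n" for i
    unfolding B_def by (subst measure_gauss_model_component[OF that]) (simp_all add: measure_gauss_abs_less)
  have PW: "measure ?P (W i) \<le> q" if "i < n" "i \<notin> S0 n \<theta>" for i
    unfolding W_def using that measure_gauss_abs_greater[OF T]
    by (subst measure_gauss_model_component[OF that(1)]) (simp_all add: S0_def q_def)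
  \<comment> \<open>\<open>c1\<close> is the Markov factor: c1 times the number of misses exceeds 1
    once more than (1-lam) pn signals are missed. \<open>c2\<close> is the slope of the tangent line
    at M.\<close>
  define c1 where "c1 = 1 / ((1 - lam) * real pn)"
  define c2 where "c2 = a / (M + a)\<^sup>2"
  have c12: "c1 \<ge> 0" "c2 \<ge> 0" using lam a M0 by (auto simp: c1_def c2_def)
  \<comment> \<open>On G, \<open>sB\<close> dominates the number of missed signals and
    \<open>sW\<close> the number of false discoveries.\<close>
  define sB where "sB = (\<lambda>X. \<Sum>i\<in>S0 n \<theta>. indicator (B i) X :: real)"
  define sW where "sW = (\<lambda>X. \<Sum>i\<in>{..<n} - S0 n \<theta>. indicator (W i) X :: real)"
  define Gc where "Gc = space ?P - G"
  have Gc: "Gc \<in> sets ?P" "measure ?P Gc \<le> \<delta>" using G prob_compl[OF G(1)] by (auto simp: Gc_def)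
  have sB0: "0 \<le> sB X" and sW0: "0 \<le> sW X" for X by (auto simp: sB_def sW_def intro!: sum_nonneg)
  have isB: "integrable ?P sB" "(\<integral>X. sB X \<partial>?P) = (\<Sum>i\<in>S0 n \<theta>. measure ?P (B i))"
    unfolding sB_def using Bm subsetD[OF S0_subset[of n \<theta>]]
    by (auto intro!: Bochner_Integration.integrable_sum simp: emeasure_eq_measure Bochner_Integration.integral_sum)
  have isW: "integrable ?P sW" "(\<integral>X. sW X \<partial>?P) = (\<Sum>i\<in>{..<n} - S0 n \<theta>. measure ?P (W i))"
    unfolding sW_def using Wm
    by (auto intro!: Bochner_Integration.integrable_sum simp: emeasure_eq_measure Bochner_Integration.integral_sum)
  have iG: "integrable ?P (indicator Gc :: _ \<Rightarrow> real)" "(\<integral>X. indicator Gc X \<partial>?P) = measure ?P Gc"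
    using Gc by (auto simp: emeasure_eq_measure)
  have EB: "(\<integral>X. sB X \<partial>?P) \<le> real pn * Phi (- v)"
    unfolding isB pn(1)[symmetric] using PB S0_subset[of n \<theta>] by (intro sum_bounded_above) auto
  have EW: "(\<integral>X. sW X \<partial>?P) \<le> M"
  proof -
    have "(\<integral>X. sW X \<partial>?P) \<le> real (card ({..<n} - S0 n \<theta>)) * q"
      unfolding isW using PW by (intro sum_bounded_above) auto
    also have "\<dots> \<le> real n * q" using q0 card_mono[of "{..<n}" "{..<n} - S0 n \<theta>"] by (intro mult_right_mono) auto
    finally show ?thesis using nq by simp
  qed
  have miss: "1 - Xi X i \<le> indicator (B i) X" if "X \<in> G" "i \<in> S0 n \<theta>" for X i
    using reject[OF that] Xi[of X i] that sets.sets_into_space[OF G(1)] by (auto simp: B_def indicator_def)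
  have falsepos: "Xi X i \<le> indicator (W i) X" if "X \<in> G" "i < n" for X i
    using accept[OF that] Xi[of X i] that sets.sets_into_space[OF G(1)] by (auto simp: W_def indicator_def)
  have "FNR n \<theta> pn Xi \<le> (\<integral>X. indicator Gc X + sB X / real pn \<partial>?P)"
    unfolding FNR_def
  proof (rule integral_mono')
    show "integrable ?P (\<lambda>X. indicator Gc X + sB X / real pn)"
      by (intro Bochner_Integration.integrable_add iG integrable_divide isB)
    fix X assume X: "X \<in> space ?P"
    show "0 \<le> indicator Gc X + sB X / real pn" using sB0 by simp
    show "(\<Sum>i\<in>S0 n \<theta>. 1 - Xi X i) / real pn \<le> indicator Gc X + sB X / real pn"
    proof (cases "X \<in> G")
      case True
      have "(\<Sum>i\<in>S0 n \<theta>. 1 - Xi X i) \<le> sB X" unfolding sB_def by (intro sum_mono miss True)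
      then have "(\<Sum>i\<in>S0 n \<theta>. 1 - Xi X i) / real pn \<le> sB X / real pn" by (intro divide_right_mono) auto
      then show ?thesis by (auto simp: indicator_def)
    next
      case False
      have "(\<Sum>i\<in>S0 n \<theta>. 1 - Xi X i) \<le> (\<Sum>i\<in>S0 n \<theta>. 1)"
        using Xi by (intro sum_mono) (metis diff_ge_0_iff_ge diff_zero insertE le_numeral_extra(3) le_numeral_extra(4) diff_self singletonD zero_le_one)
      then have "(\<Sum>i\<in>S0 n \<theta>. 1 - Xi X i) / real pn \<le> 1" using pn by (simp add: field_simps)
      moreover have "indicator Gc X = (1::real)" using X False by (simp add: Gc_def)
      ultimately show ?thesis using sB0[of X] by (smt (verit) divide_nonneg_nonneg of_nat_0_le_iff)
    qed
  qed
  also have "\<dots> = measure ?P Gc + (\<integral>X. sB X \<partial>?P) / real pn"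
    using iG isB(1) by (subst Bochner_Integration.integral_add) (auto intro!: integrable_divide)
  also have "\<dots> \<le> \<delta> + real pn * Phi (- v) / real pn"
    using Gc EB by (intro add_mono divide_right_mono) auto
  also have "\<dots> = \<delta> + Phi (- v)" using pn by simp
  finally have FNR: "FNR n \<theta> pn Xi \<le> \<delta> + Phi (- v)" .
  \<comment> \<open>The summands of the majorant cover, in turn, the complement of G, too many
    missed signals, and the remaining case, in which at least lam pn signals are found.\<close>
  have "FDR n \<theta> Xi \<le> (\<integral>X. indicator Gc X + c1 * sB X + (M\<^sup>2 / (M + a)\<^sup>2 + c2 * sW X) \<partial>?P)"
    unfolding FDR_def
  proof (rule integral_mono')
    show "integrable ?P (\<lambda>X. indicator Gc X + c1 * sB X + (M\<^sup>2 / (M + a)\<^sup>2 + c2 * sW X))"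
      by (intro Bochner_Integration.integrable_add iG integrable_mult_right isB isW) simp
    fix X assume X: "X \<in> space ?P"
    have nn: "0 \<le> (indicator Gc X :: real)" "0 \<le> c1 * sB X" "0 \<le> M\<^sup>2 / (M + a)\<^sup>2 + c2 * sW X"
      using sB0 sW0 c12 by auto
    then show "0 \<le> indicator Gc X + c1 * sB X + (M\<^sup>2 / (M + a)\<^sup>2 + c2 * sW X)" by simp
    let ?fdp = "(\<Sum>i\<in>{..<n} - S0 n \<theta>. Xi X i) / max (\<Sum>i<n. Xi X i) 1"
    have fdp1: "?fdp \<le> 1" by (rule false_discovery_proportion_le_1[OF Xi])
    consider "X \<notin> G" | "sB X > (1 - lam) * real pn" | "X \<in> G" "sB X \<le> (1 - lam) * real pn" by linarith
    then show "?fdp \<le> indicator Gc X + c1 * sB X + (M\<^sup>2 / (M + a)\<^sup>2 + c2 * sW X)"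
    proof cases
      case 1
      then have "indicator Gc X = (1::real)" using X by (simp add: Gc_def)
      then show ?thesis using fdp1 nn by linarith
    next
      case 2
      have "(1 - lam) * real pn > 0" using lam pn by simp
      then have "1 \<le> c1 * sB X" using 2 unfolding c1_def by simp
      then show ?thesis using fdp1 nn by linarith
    next
      case 3
      have "(\<Sum>i\<in>S0 n \<theta>. 1 - Xi X i) \<le> sB X" unfolding sB_def by (intro sum_mono miss 3)
      then have "real pn - (\<Sum>i\<in>S0 n \<theta>. Xi X i) \<le> sB X" using pn by (simp add: sum_subtractf)
      then have S: "a \<le> (\<Sum>i\<in>S0 n \<theta>. Xi X i)" using 3(2) by (simp add: a_def algebra_simps)
      have V: "(\<Sum>i\<in>{..<n} - S0 n \<theta>. Xi X i) \<le> sW X" unfolding sW_def by (intro sum_mono falsepos 3) auto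
      have "?fdp \<le> sW X / (sW X + a)" by (rule false_discovery_proportion_le[OF Xi V a S])
      also have "\<dots> \<le> M\<^sup>2 / (M + a)\<^sup>2 + c2 * sW X"
        unfolding c2_def by (rule frac_le_tangent[OF sW0 a M0])
      finally show ?thesis using nn by linarith
    qed
  qed
  also have "\<dots> = measure ?P Gc + c1 * (\<integral>X. sB X \<partial>?P) + (M\<^sup>2 / (M + a)\<^sup>2 + c2 * (\<integral>X. sW X \<partial>?P))"
    using iG isB(1) isW(1) by (simp add: prob_space)
  also have "\<dots> \<le> \<delta> + c1 * (real pn * Phi (- v)) + (M\<^sup>2 / (M + a)\<^sup>2 + c2 * M)"
    using Gc EB EW c12 by (intro add_mono mult_left_mono) auto
  also have "c1 * (real pn * Phi (- v)) = Phi (- v) / (1 - lam)" using pn by (simp add: c1_def)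
  \<comment> \<open>At w = M the tangent line meets the curve, so nothing is lost beyond the bound
    on the mean.\<close>
  also have "M\<^sup>2 / (M + a)\<^sup>2 + c2 * M = M / (M + a)"
  proof -
    have "M\<^sup>2 / (M + a)\<^sup>2 + c2 * M = M * (M + a) / ((M + a) * (M + a))"
      unfolding c2_def by (simp add: power2_eq_square add_divide_distrib algebra_simps)
    then show ?thesis using M0 a by simp
  qed
  finally show ?thesis using FNR unfolding Rsup_def a_def by linarith
qed

section \<open>The adaptive test\<close>

text \<open>The bound of \<open>m_post_le\<close> increases with x^2 and, on (0, 1/e], with p/n. Its
  value at x^2/2 = W and p/n = t therefore covers every admissible estimate and every smaller
  observation.\<close>

lemma m_post_le_threshold:
  fixes \<alpha> c C t p :: real
  assumes pd: "prior_density \<pi>" and c2: "cond2 \<pi> c" and c3: "cond3 \<pi> n p C"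
    and p: "0 < p" "p / real n \<le> t" and n: "n > 0" and C: "C \<ge> 0"
    and t: "t \<le> exp (-1)" "t * ln (1 / t) \<le> 1"
    and W: "sqrt 2 / c * (t * ln (1 / t) * exp (W * (t * ln (1 / t))) + C * (t * ln (1 / t)) * exp (W / 2)
       + C * (t * sqrt (ln (1 / t))) * exp W) \<le> \<alpha>"
    and x: "x\<^sup>2 / 2 \<le> W"
  shows "m_post \<pi> x \<le> \<alpha>"
proof -
  define a where "a = p / real n"
  have a: "0 < a" "a \<le> t" using p n by (auto simp: a_def)
  have la: "ln (real n / p) = ln (1 / a)" by (simp add: a_def)
  have la1: "ln (1 / a) \<ge> 1" using a t ln_mono[of a "exp (-1)"] by (simp add: ln_div)
  have s: "s_n n p = a * ln (1 / a)" using la1 by (simp add: s_n_def tau_n_def nu_n_def la a_def[symmetric])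
  have nu: "nu_n n p = sqrt (ln (1 / a))" by (simp add: nu_n_def la)
  have sn: "s_n n p / nu_n n p = a * sqrt (ln (1 / a))"
    unfolding s nu times_divide_eq_right[symmetric] using la1 real_div_sqrt[of "ln (1 / a)"] by simp
  have mono: "a * ln (1 / a) \<le> t * ln (1 / t)" by (rule mult_ln_inverse_mono[OF a t(1)])
  have mono2: "a * sqrt (ln (1 / a)) \<le> t * sqrt (ln (1 / t))" by (rule mult_sqrt_ln_inverse_mono[OF a t(1)])
  have la0: "ln (1 / a) > 0" using la1 by linarith
  have s0: "0 < a * ln (1 / a)" "0 < a * sqrt (ln (1 / a))" using mult_pos_pos[OF a(1) la0] mult_pos_pos[OF a(1), of "sqrt (ln (1 / a))"] la0 by auto
  have c: "c > 0" using c2 by (simp add: cond2_def)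
  have W0: "W \<ge> 0" using x by (meson zero_le_power2 divide_nonneg_nonneg order_trans zero_le_numeral)
  have x4: "x\<^sup>2 / 4 \<le> W / 2" using x by simp
  have "m_post \<pi> x \<le> sqrt 2 / c * (a * ln (1 / a) * exp (x\<^sup>2 / 2 * (a * ln (1 / a))) + C * (a * ln (1 / a)) * exp (x\<^sup>2 / 4)
     + C * (a * sqrt (ln (1 / a))) * exp (x\<^sup>2 / 2))"
  proof -
    have "nu_n n p \<ge> 1" unfolding nu using la1 by simp
    moreover have "s_n n p > 0" unfolding s by (rule s0(1))
    moreover have "s_n n p \<le> 1" unfolding s using mono t(2) by (rule order_trans)
    ultimately have nus: "nu_n n p \<ge> 1" "s_n n p > 0" "s_n n p \<le> 1" .
    note m_post_le[OF pd c2 c3 nus, of x]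
    then show ?thesis unfolding sn unfolding s .
  qed
  also have "\<dots> \<le> sqrt 2 / c * (t * ln (1 / t) * exp (W * (t * ln (1 / t))) + C * (t * ln (1 / t)) * exp (W / 2)
       + C * (t * sqrt (ln (1 / t))) * exp W)"
  proof -
    have "exp (x\<^sup>2 / 2 * (a * ln (1 / a))) \<le> exp (W * (t * ln (1 / t)))"
      unfolding exp_le_cancel_iff using s0(1) by (intro mult_mono[OF x mono W0]) simp
    then have "a * ln (1 / a) * exp (x\<^sup>2 / 2 * (a * ln (1 / a))) \<le> t * ln (1 / t) * exp (W * (t * ln (1 / t)))"
      using s0(1) mono by (intro mult_mono[OF mono]) auto
    moreover have "C * (a * ln (1 / a)) * exp (x\<^sup>2 / 4) \<le> C * (t * ln (1 / t)) * exp (W / 2)"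
      using C s0(1) mono x4 by (intro mult_mono[OF mult_left_mono[OF mono C]] mult_nonneg_nonneg[OF C]) auto
    moreover have "C * (a * sqrt (ln (1 / a))) * exp (x\<^sup>2 / 2) \<le> C * (t * sqrt (ln (1 / t))) * exp W"
      using C s0(2) mono2 x by (intro mult_mono[OF mult_left_mono[OF mono2 C]] mult_nonneg_nonneg[OF C]) auto
    ultimately show ?thesis using c by (intro mult_left_mono add_mono) auto
  qed
  also have "\<dots> \<le> \<alpha>" by (rule W)
  finally show ?thesis .
qed

text \<open>The choice of W gives exp(-T^2/2) = t v/B with v = sqrt(ln(1/t)). The factor v is
  cancelled by T \<ge> v in the tail bound, and n t = Cu pn remains.\<close>

lemma expected_exceedances_le:
  fixes \<alpha> c C Cu pn :: real
  assumes pos: "\<alpha> > 0" "c > 0" "C > 0" "Cu > 0" "pn > 0" "n > 0" and B: "B = \<alpha> * c / (2 * C)"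
    and t: "t = Cu * pn / real n" "t \<le> exp (-1)" and W: "W = ln (B / (t * sqrt (ln (1 / t))))"
      "ln (1 / t) \<le> 2 * W" and T: "T = sqrt (2 * W)"
  shows "real n * (2 * exp (- T\<^sup>2 / 2) / (sqrt (2 * pi) * T)) \<le> 8 * Cu * C * sqrt pi * pn / (\<alpha> * c)"
proof -
  define v where "v = sqrt (ln (1 / t))"
  have t0: "t > 0" using t pos by simp
  have "ln (1 / t) \<ge> 1" using t0 t(2) ln_mono[of t "exp (-1)"] by (simp add: ln_div)
  then have v: "v > 0" "W > 0" using W(2) by (auto simp: v_def)
  have vT: "v \<le> T" unfolding v_def T by (intro real_sqrt_le_mono W(2))
  have B0: "B > 0" using pos B by simp
  have "T\<^sup>2 = 2 * W" using v by (simp add: T)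
  then have "exp (- T\<^sup>2 / 2) = inverse (exp W)" by (simp add: exp_minus)
  also have "exp W = B / (t * v)" unfolding W(1) v_def[symmetric] using B0 t0 v by (intro exp_ln) auto
  finally have e: "exp (- T\<^sup>2 / 2) = t * v / B" by simp
  have "real n * (2 * exp (- T\<^sup>2 / 2) / (sqrt (2 * pi) * T)) = 2 * (real n * t) / (B * sqrt (2 * pi)) * (v / T)"
    unfolding e by (simp add: mult_ac)
  also have "\<dots> \<le> 2 * (real n * t) / (B * sqrt (2 * pi)) * 1"
    using vT v t0 B0 by (intro mult_left_mono) auto
  also have "real n * t = Cu * pn" using t pos by simp
  also have "2 * (Cu * pn) / (B * sqrt (2 * pi)) * 1 = (Cu * C * pn / (\<alpha> * c)) * (4 / sqrt (2 * pi))"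
    using pos by (simp add: B)
  \<comment> \<open>The computed factor 4/sqrt(2 pi) is enlarged to 8 sqrt pi to match the constant
    in the theorem.\<close>
  also have "\<dots> \<le> (Cu * C * pn / (\<alpha> * c)) * (8 * sqrt pi)"
  proof (rule mult_left_mono)
    have "sqrt 1 \<le> sqrt 2" "0 \<le> pi" by (auto intro: real_sqrt_le_mono)
    then have "1 * 3 \<le> sqrt 2 * pi" using pi_gt3 by (intro mult_mono) auto
    then have "4 \<le> 8 * (sqrt 2 * pi)" by linarith
    also have "\<dots> = 8 * sqrt pi * sqrt (2 * pi)" by (simp add: real_sqrt_mult)
    finally show "4 / sqrt (2 * pi) \<le> 8 * sqrt pi" by (simp add: pos_divide_le_eq)
  qed (use pos in auto)
  finally show ?thesis by (simp add: mult_ac)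
qed

lemma cond3_mono:
  assumes "cond3 \<pi> n p C" "C \<le> C2" "s_n n p \<ge> 0" shows "cond3 \<pi> n p C2"
  using assms mult_right_mono[OF assms(2,3)] unfolding cond3_def by linarith

(* For C = 0 the quotient by C is 0 and the right-hand side is 1. *)
lemma fdr_constant_le:
  assumes "\<alpha> > 0" "c > 0" "C \<ge> 0" "Cu > 0" "lam > 0" "pn > 0"
    and C2: "C2 = (if C = 0 then 1 else C)" and M: "M = 8 * Cu * C2 * sqrt pi * pn / (\<alpha> * c)"
  shows "M / (M + lam * pn) \<le> 1 / (1 + lam * \<alpha> * c / (8 * Cu * C * sqrt pi))"
proof (cases "C = 0")
  case True
  have "M \<ge> 0" "lam * pn > 0" using assms by auto
  then show ?thesis using True by (simp add: divide_le_eq_1)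
next
  case False
  then have C: "C > 0" "C2 = C" using assms by auto
  then have M0: "M > 0" using assms by simp
  have "1 / (1 + lam * \<alpha> * c / (8 * Cu * C * sqrt pi)) = 1 / (1 + lam * pn / M)"
    unfolding M C using assms C by simp
  also have "1 + lam * pn / M = (M + lam * pn) / M" using M0 by (simp add: add_divide_distrib)
  finally show ?thesis by simp
qed

text \<open>\<open>C1\<close> is quantified before K, c, C, Cu and all sequences, so it depends on
  the fixed parameters only. The sequence \<open>e\<close> is the o(1) term; it precedes \<theta>,
  which makes the bound uniform and hence a bound on the supremum.\<close>

theorem theorem4:
  fixes \<alpha> ustar u0 R b b' C' :: real
  assumes "0 < \<alpha>" "\<alpha> < 1"
  shows "\<exists>C1::real. \<forall>(K::real) (c::real) (C::real) (Cu::real) (pn::nat \<Rightarrow> nat) (\<gamma>::nat \<Rightarrow> real)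
     (\<rho>0::nat \<Rightarrow> real) (phat::nat \<Rightarrow> (nat \<Rightarrow> real) \<Rightarrow> real) (pri::nat \<Rightarrow> real \<Rightarrow> real \<Rightarrow> real).
     ((\<lambda>n. real (pn n) / real n) \<longlonglongrightarrow> 0)
     \<and> (\<forall>n. 1 \<le> \<gamma> n \<and> \<gamma> n \<le> real (pn n))
     \<and> Cu > 0
     \<and> (\<forall>n. phat n \<in> borel_measurable (PiM {..<n} (\<lambda>_. lborel)))
     \<and> (\<exists>\<delta>. \<delta> \<longlonglongrightarrow> 0 \<and>
          (\<forall>n \<theta>. card (S0 n \<theta>) = pn n \<and> (\<forall>i\<in>S0 n \<theta>. \<bar>\<theta> i\<bar> \<ge> \<rho>0 n) \<longrightarrow>
             measure (gauss_model n \<theta>)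
               {X \<in> space (gauss_model n \<theta>). \<gamma> n \<le> phat n X \<and> phat n X \<le> Cu * real (pn n)}
             \<ge> 1 - \<delta> n))
     \<and> (\<forall>n. \<forall>X \<in> (\<Pi>\<^sub>E i\<in>{..<n}. (UNIV::real set)).
          prior_density (pri n (phat n X))
          \<and> cond1 (pri n (phat n X)) n (phat n X) b R u0 C' b' K ustar
          \<and> cond2 (pri n (phat n X)) c
          \<and> cond3 (pri n (phat n X)) n (phat n X) C)
     \<longrightarrow>
     (\<forall>(v::nat \<Rightarrow> real) (lam::real).
        filterlim v at_top sequentially \<and> 0 < lam \<and> (\<forall>n. lam < Phi (v n)) \<longrightarrow>
        (\<exists>e::nat \<Rightarrow> real. e \<longlonglongrightarrow> 0 \<and>
           (\<forall>\<^sub>F n in sequentially. \<forall>\<theta>::nat \<Rightarrow> real.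
              card (S0 n \<theta>) = pn n
              \<and> (\<forall>i\<in>S0 n \<theta>. \<bar>\<theta> i\<bar> \<ge>
                   max (C1 + sqrt (2 * K * (u0 + 1) * ln (real n / \<gamma> n)) + v n) (\<rho>0 n))
              \<longrightarrow> Rsup n \<theta> (pn n) (xi_test pri phat \<alpha> n)
                  \<le> (1 / (1 + lam * \<alpha> * c / (8 * Cu * C * sqrt pi)) + Phi (- v n)) * (1 + e n))))"
proof -
  obtain C1 where C1: "\<And>\<pi> n p K x. prior_density \<pi> \<Longrightarrow> cond1 \<pi> n p b R u0 C' b' K ustar \<Longrightarrow> 0 < p \<Longrightarrow> p \<le> real n \<Longrightarrow>
     \<bar>x\<bar> \<ge> C1 + sqrt (2 * K * (u0 + 1) * ln (real n / p)) \<Longrightarrow> m_post \<pi> x > \<alpha>"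
    using m_post_gt[OF assms(2), of b R u0 C' b' ustar] by blast
  show ?thesis
  proof (rule exI[of _ C1], intro allI impI, elim conjE exE, goal_cases)
    case (1 K c C Cu pn \<gamma> \<rho>0 phat pri v lam \<delta>)
    note pn0 = 1(1) and v = 1(2) and \<gamma> = 1(3) and lam0 = 1(4) and lam = 1(5) and Cu = 1(6)
      and phat = 1(7) and cond = 1(8) and \<delta>0 = 1(9) and \<delta> = 1(10)
    \<comment> \<open>For n = 0 the sample space is a single point. Evaluating the conditions on the
      prior there yields the signs of c, K and u0.\<close>
    have X0: "(\<lambda>_. undefined :: real) \<in> {..<0::nat} \<rightarrow>\<^sub>E UNIV" by simp
    have c: "c > 0" and K: "K \<ge> 0" and u0: "u0 > 0"
      using cond[rule_format, OF X0] by (auto simp: cond1_def cond2_def unif_reg_varying_def)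
    have lam1: "lam < 1" using lam[rule_format, of 0] Phi_le_1[of "v 0"] by linarith
    \<comment> \<open>The threshold divides by the constant of Condition 3; if C = 0, that condition
      still holds with 1 in its place.\<close>
    define C2 where "C2 = (if C = 0 then 1 else C)"
    define B where "B = \<alpha> * c / (2 * C2)"
    define A where "A = lam * \<alpha> * c / (8 * Cu * C * sqrt pi)"
    \<comment> \<open>The additive errors: the bad event enters once through the FDR and once
      through the FNR, and the last term is Markov's inequality for the missed signals.\<close>
    define \<eta> where "\<eta> = (\<lambda>n. 2 * \<bar>\<delta> n\<bar> + Phi (- v n) / (1 - lam))"
    \<comment> \<open>The largest value of p/n that the estimate can produce on the good
      event.\<close>
    define t where "t = (\<lambda>n. Cu * real (pn n) / real n)"
    define Q where "Q = (\<lambda>t. let W = ln (B / (t * sqrt (ln (1 / t)))) in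
       0 < t \<and> t \<le> exp (-1) \<and> t * ln (1 / t) \<le> 1 \<and> ln (1 / t) \<le> 2 * W \<and>
       sqrt 2 / c * (t * ln (1 / t) * exp (W * (t * ln (1 / t))) + C2 * (t * ln (1 / t)) * exp (W / 2)
         + C2 * (t * sqrt (ln (1 / t))) * exp W) \<le> \<alpha>)"
    have pn1: "pn n \<ge> 1" for n using \<gamma>[rule_format, of n] by linarith
    have t0: "filterlim t (at_right 0) sequentially"
    proof (rule filterlim_at_withinI)
      have "(\<lambda>n. Cu * (real (pn n) / real n)) \<longlonglongrightarrow> Cu * 0" by (intro tendsto_intros pn0)
      then show "t \<longlonglongrightarrow> 0" by (simp add: t_def)
      show "\<forall>\<^sub>F n in sequentially. t n \<in> {0<..} - {0}"
        using eventually_gt_at_top[of 0]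
      proof eventually_elim
        case (elim n)
        then show ?case using Cu pn1[of n] by (simp add: t_def)
      qed
    qed
    have Phi0: "(\<lambda>n. Phi (- v n)) \<longlonglongrightarrow> 0"
      by (rule filterlim_compose[OF Phi_at_bot]) (rule filterlim_compose[OF filterlim_uminus_at_bot_at_top v])
    have "\<eta> \<longlonglongrightarrow> 2 * \<bar>0\<bar> + 0 / (1 - lam)"
      unfolding \<eta>_def using lam1 by (intro tendsto_intros \<delta>0 Phi0) auto
    then have "(\<lambda>n. \<eta> n * (1 + A)) \<longlonglongrightarrow> 0" by (auto intro: tendsto_mult_left_zero)
    moreover have "\<forall>\<^sub>F n in sequentially. \<forall>\<theta>. card (S0 n \<theta>) = pn n \<and>
        (\<forall>i\<in>S0 n \<theta>. \<bar>\<theta> i\<bar> \<ge> max (C1 + sqrt (2 * K * (u0 + 1) * ln (real n / \<gamma> n)) + v n) (\<rho>0 n)) \<longrightarrow>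
        Rsup n \<theta> (pn n) (xi_test pri phat \<alpha> n) \<le> (1 / (1 + A) + Phi (- v n)) * (1 + \<eta> n * (1 + A))"
    proof (cases "C \<ge> 0")
      case C0: True
      then have C2: "C2 > 0" "C \<le> C2" by (auto simp: C2_def)
      have A: "A \<ge> 0" using C0 lam0 assms c Cu by (simp add: A_def)
      have "eventually Q (at_right 0)"
        unfolding Q_def by (rule eventually_threshold[OF assms(1) c C2(1) B_def])
      then have "\<forall>\<^sub>F n in sequentially. Q (t n)" using t0 by (rule eventually_compose_filterlim)
      then show ?thesis using eventually_gt_at_top[of 0]
      proof eventually_elim
        case (elim n)
        define W where "W = ln (B / (t n * sqrt (ln (1 / t n))))"
        have tQ: "0 < t n" "t n \<le> exp (-1)" "t n * ln (1 / t n) \<le> 1" "ln (1 / t n) \<le> 2 * W"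
          "sqrt 2 / c * (t n * ln (1 / t n) * exp (W * (t n * ln (1 / t n))) + C2 * (t n * ln (1 / t n)) * exp (W / 2)
             + C2 * (t n * sqrt (ln (1 / t n))) * exp W) \<le> \<alpha>"
          using elim(1) unfolding Q_def Let_def W_def by auto
        have "ln (1 / t n) \<ge> 1" using tQ ln_mono[of "t n" "exp (-1)"] by (simp add: ln_div)
        then have W0: "W > 0" using tQ by linarith
        define T where "T = sqrt (2 * W)"
        define M where "M = 8 * Cu * C2 * sqrt pi * real (pn n) / (\<alpha> * c)"
        have pp: "real (pn n) > 0" using pn1[of n] by simp
        show ?case
        proof (intro allI impI, elim conjE)
          fix \<theta>
          assume card: "card (S0 n \<theta>) = pn n"
            and \<theta>: "\<forall>i\<in>S0 n \<theta>. \<bar>\<theta> i\<bar> \<ge> max (C1 + sqrt (2 * K * (u0 + 1) * ln (real n / \<gamma> n)) + v n) (\<rho>0 n)"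
          let ?P = "gauss_model n \<theta>"
          define G where "G = {X \<in> space ?P. \<gamma> n \<le> phat n X \<and> phat n X \<le> Cu * real (pn n)}"
          have [measurable]: "phat n \<in> borel_measurable ?P"
            using phat[rule_format, of n] sets_gauss_model[of n \<theta>] by (simp cong: measurable_cong_sets)
          have G: "G \<in> sets ?P" unfolding G_def by measurable
          have "1 - \<delta> n \<le> measure ?P G" unfolding G_def using \<delta> card \<theta> by auto
          then have PG: "1 - \<bar>\<delta> n\<bar> \<le> measure ?P G" by linarith
          have good: "prior_density (pri n p)" "cond1 (pri n p) n p b R u0 C' b' K ustar" "cond2 (pri n p) c"
            "cond3 (pri n p) n p C2" "0 < p" "p / real n \<le> t n" "p \<le> real n"
            if "X \<in> G" "p = phat n X" for X p
          proof -
            have X: "X \<in> {..<n} \<rightarrow>\<^sub>E UNIV" "\<gamma> n \<le> p" "p \<le> Cu * real (pn n)"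
              using that by (auto simp: G_def space_gauss_model)
            show "prior_density (pri n p)" "cond1 (pri n p) n p b R u0 C' b' K ustar" "cond2 (pri n p) c"
              using cond[rule_format, OF X(1)] that by auto
            have c3: "cond3 (pri n p) n p C" using cond[rule_format, OF X(1)] that by auto
            show p: "0 < p" using X(2) \<gamma>[rule_format, of n] by linarith
            show pt: "p / real n \<le> t n" unfolding t_def using X(3) by (intro divide_right_mono) auto
            also have "\<dots> \<le> 1" using tQ(2) by (rule order_trans) simp
            finally show "p \<le> real n" using elim(2) by simp
            then have "s_n n p \<ge> 0" using p by (simp add: s_n_def tau_n_def)
            then show "cond3 (pri n p) n p C2" by (rule cond3_mono[OF c3 C2(2)])
          qed
          have "Rsup n \<theta> (pn n) (xi_test pri phat \<alpha> n)
            \<le> M / (M + lam * real (pn n)) + Phi (- v n) + (2 * \<bar>\<delta> n\<bar> + Phi (- v n) / (1 - lam))"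
          proof (rule Rsup_le[OF _ G PG card _ _ _ _ _ lam0 lam1])
            show "xi_test pri phat \<alpha> n X i \<in> {0, 1}" for X i by (simp add: xi_test_def)
            show "pn n > 0" using pn1[of n] by simp
            show "T > 0" using W0 by (simp add: T_def)
            show "real n * (2 * exp (- T\<^sup>2 / 2) / (sqrt (2 * pi) * T)) \<le> M"
              unfolding M_def
              by (rule expected_exceedances_le[OF assms(1) c C2(1) Cu pp elim(2) B_def _ tQ(2) W_def tQ(4) T_def])
                (simp add: t_def)
            show "xi_test pri phat \<alpha> n X i = 0" if X: "X \<in> G" and i: "i < n" and le: "\<bar>X i\<bar> \<le> T" for X i
            proof -
              have "\<bar>X i\<bar>\<^sup>2 \<le> T\<^sup>2" using le by (intro power_mono) auto
              then have x: "(X i)\<^sup>2 / 2 \<le> W" using W0 by (simp add: T_def)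
              have "m_post (pri n (phat n X)) (X i) \<le> \<alpha>"
                by (rule m_post_le_threshold[OF good(1)[OF X refl] good(3)[OF X refl] good(4)[OF X refl] good(5)[OF X refl]
                      good(6)[OF X refl] elim(2) less_imp_le[OF C2(1)] tQ(2,3,5) x])
              then show ?thesis by (simp add: xi_test_def)
            qed
            show "xi_test pri phat \<alpha> n X i = 1" if X: "X \<in> G" and i: "i \<in> S0 n \<theta>" and ge: "\<bar>X i\<bar> \<ge> \<bar>\<theta> i\<bar> - v n" for X i
            proof -
              \<comment> \<open>On G the estimate is at least \<gamma> n, so the detection level at
                the estimate does not exceed the one at \<gamma> n; the margin v n absorbs the
                noise.\<close>
              have g0: "0 < \<gamma> n" using \<gamma>[rule_format, of n] by linarith
              have "real n / phat n X \<le> real n / \<gamma> n"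
                using X g0 by (intro divide_left_mono) (auto simp: G_def)
              then have "ln (real n / phat n X) \<le> ln (real n / \<gamma> n)"
                using good(5)[OF X refl] elim(2) by (intro ln_mono) auto
              then have "sqrt (2 * K * (u0 + 1) * ln (real n / phat n X)) \<le> sqrt (2 * K * (u0 + 1) * ln (real n / \<gamma> n))"
                using K u0 by (intro real_sqrt_le_mono mult_left_mono) auto
              moreover have "C1 + sqrt (2 * K * (u0 + 1) * ln (real n / \<gamma> n)) + v n \<le> \<bar>\<theta> i\<bar>"
                using \<theta> i by auto
              ultimately have "\<bar>X i\<bar> \<ge> C1 + sqrt (2 * K * (u0 + 1) * ln (real n / phat n X))" using ge by linarith
              from C1[OF good(1)[OF X refl] good(2)[OF X refl] good(5)[OF X refl] good(7)[OF X refl] this]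
              show ?thesis by (simp add: xi_test_def)
            qed
          qed
          also have "\<dots> \<le> 1 / (1 + A) + Phi (- v n) + \<eta> n"
            using fdr_constant_le[OF assms(1) c C0 Cu lam0 pp C2_def M_def] by (simp add: A_def \<eta>_def)
          \<comment> \<open>The additive error becomes relative: the main term is at least 1/(1+A),
            which explains the factor 1+A.\<close>
          also have "\<dots> \<le> (1 / (1 + A) + Phi (- v n)) * (1 + \<eta> n * (1 + A))"
          proof -
            have "0 \<le> \<eta> n" using lam1 Phi_nonneg by (simp add: \<eta>_def)
            then have "0 \<le> Phi (- v n) * (\<eta> n * (1 + A))" using A Phi_nonneg by simp
            moreover have "1 / (1 + A) * (\<eta> n * (1 + A)) = \<eta> n" using A by simp
            ultimately show ?thesis unfolding distrib_left distrib_right by linarith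
          qed
          finally show "Rsup n \<theta> (pn n) (xi_test pri phat \<alpha> n) \<le> (1 / (1 + A) + Phi (- v n)) * (1 + \<eta> n * (1 + A))" .
        qed
      qed
    next
      case False
      \<comment> \<open>For C < 0 the claim is vacuous for large n: an admissible \<theta> would
        make the good event nonempty, and at any of its points Condition 3 forces C \<ge> 0.\<close>
      have "\<forall>\<^sub>F x in at_right 0. x < exp (-1 :: real)"
        by (rule order_tendstoD(2)[OF tendsto_ident_at]) simp
      then have "\<forall>\<^sub>F x in at_right 0. x \<le> exp (-1 :: real)" by eventually_elim simp
      then have "\<forall>\<^sub>F n in sequentially. t n \<le> exp (-1)" using t0 by (rule eventually_compose_filterlim)
      moreover have "\<forall>\<^sub>F n in sequentially. \<delta> n < 1" using \<delta>0 by (rule order_tendstoD) simp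
      ultimately show ?thesis using eventually_gt_at_top[of 0]
      proof eventually_elim
        case (elim n)
        have False if card: "card (S0 n \<theta>) = pn n"
            and \<theta>: "\<forall>i\<in>S0 n \<theta>. \<bar>\<theta> i\<bar> \<ge> max (C1 + sqrt (2 * K * (u0 + 1) * ln (real n / \<gamma> n)) + v n) (\<rho>0 n)" for \<theta>
        proof -
          let ?P = "gauss_model n \<theta>"
          define G where "G = {X \<in> space ?P. \<gamma> n \<le> phat n X \<and> phat n X \<le> Cu * real (pn n)}"
          have "1 - \<delta> n \<le> measure ?P G" unfolding G_def using \<delta> card \<theta> by auto
          then have "G \<noteq> {}" using elim(2) by auto
          then obtain X where X: "X \<in> {..<n} \<rightarrow>\<^sub>E UNIV" "\<gamma> n \<le> phat n X" "phat n X \<le> Cu * real (pn n)"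
            by (auto simp: G_def space_gauss_model)
          define p where "p = phat n X"
          have p: "p > 0" using X(2) \<gamma>[rule_format, of n] unfolding p_def by linarith
          have "p / real n \<le> t n" unfolding t_def p_def using X(3) by (intro divide_right_mono) auto
          also have "\<dots> < 1" using elim(1) by (rule le_less_trans) simp
          finally have pn: "p < real n" using elim(3) by simp
          then have nu: "nu_n n p > 0" using p by (simp add: nu_n_def)
          moreover have "tau_n n p > 0" using p elim(3) by (simp add: tau_n_def)
          ultimately have "s_n n p > 0" by (simp add: s_n_def)
          then have "C \<ge> 0"
            using cond3_const_nonneg[of "pri n p" n p C] cond[rule_format, OF X(1), folded p_def] nu by linarith
          then show False using False by simp
        qed
        then show ?case by blast
      qed
    qed
    ultimately show ?case unfolding A_def by blast
  qed
qed

end
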